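(* Let $\mathcal{S}$ be an operator system in $M_n$. Suppose there is a unitary $U\in M_n$ such that $U^*\mathcal{S}U=\{U^*SU: S\in\mathcal{S}\}$ has a spanning set which is a subset of $$\{E_{jj}: 1 \le j \le n\} \cup \{E_{2j-1,2j}+E_{2j,2j-1}: 1 \le j\le n/2\}.$$ Then $\mathcal{S}$ is a maximal operator system.
   Context: $M_n$ is the algebra of $n\times n$ complex matrices, identified with $\mathcal{B}(\mathbb{C}^n)$, and $\{E_{ij}\}$ is its standard basis of matrix units. $\mathcal{B}(\mathcal{K})$ is the algebra of bounded linear operators on a complex Hilbert space $\mathcal{K}$. An operator system in $M_n$ is a self-adjoint linear subspace containing the identity $I_n$. A linear map $\Phi:\mathcal{S}\to\mathcal{B}(\mathcal{K})$ is unital if $\Phi(I_n)=I_{\mathcal{K}}$, positive if it maps positive semidefinite elements of $\mathcal{S}$ to positive semidefinite operators, and completely positive if for every $k\ge1$ the map $M_k(\mathcal{S})\to M_k(\mathcal{B}(\mathcal{K}))$, $(S_{ij})\mapsto(\Phi(S_{ij}))$, is positive. An operator system $\mathcal{S}$ is a maximal operator system (OMAX) if, for every Hilbert space $\mathcal{K}$, every unital positive map $\Phi:\mathcal{S}\to\mathcal{B}(\mathcal{K})$ is completely positive. *)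

theory Defs
  imports
    Complex_Main
    "HOL-Library.Nonpos_Ints"
    "Jordan_Normal_Form.Matrix"
    "Jordan_Normal_Form.VS_Connect"
    "Jordan_Normal_Form.Schur_Decomposition"
begin

section \<open>Complex Hilbert spaces and their bounded operators\<close>

text \<open>
  The inner product is linear in its second argument. Completeness comes from the class
  \<^class>\<open>banach\<close>, and positive definiteness of the inner product from that of the norm.
\<close>

class complex_hilbert_space = banach +
  fixes scale_complex :: "complex \<Rightarrow> 'a \<Rightarrow> 'a" (infixr \<open>*\<^sub>C\<close> 75)
    and cinner :: "'a \<Rightarrow> 'a \<Rightarrow> complex"
  assumes scale_complex_add_right: "a *\<^sub>C (x + y) = a *\<^sub>C x + a *\<^sub>C y"
    and scale_complex_add_left: "(a + b) *\<^sub>C x = a *\<^sub>C x + b *\<^sub>C x"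
    and scale_complex_assoc: "a *\<^sub>C (b *\<^sub>C x) = (a * b) *\<^sub>C x"
    and scale_complex_of_real: "complex_of_real r *\<^sub>C x = r *\<^sub>R x"
    and cinner_commute: "cinner x y = cnj (cinner y x)"
    and cinner_add_right: "cinner x (y + z) = cinner x y + cinner x z"
    and cinner_scale_right: "cinner x (a *\<^sub>C y) = a * cinner x y"
    and cinner_self: "cinner x x = complex_of_real ((norm x)\<^sup>2)"

definition bounded_operators :: "('k::complex_hilbert_space \<Rightarrow> 'k) set" where
  "bounded_operators = {T. bounded_linear T \<and> (\<forall>c x. T (c *\<^sub>C x) = c *\<^sub>C T x)}"

definition positive_op :: "('k::complex_hilbert_space \<Rightarrow> 'k) \<Rightarrow> bool" where
  "positive_op T \<longleftrightarrow> T \<in> bounded_operators \<and> (\<forall>x. cinner x (T x) \<in> \<real>\<^sub>\<ge>\<^sub>0)"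

text \<open>
  A \<open>k \<times> k\<close> matrix of operators acts on the \<open>k\<close>-fold Hilbert direct sum, whose elements are
  families \<open>x 0, \<dots>, x (k - 1)\<close>; values of \<open>x\<close> and \<open>T\<close> at other indices play no role.
\<close>

definition block_op_apply ::
    "nat \<Rightarrow> (nat \<Rightarrow> nat \<Rightarrow> 'k::complex_hilbert_space \<Rightarrow> 'k) \<Rightarrow> (nat \<Rightarrow> 'k) \<Rightarrow> nat \<Rightarrow> 'k" where
  "block_op_apply k T x = (\<lambda>i. \<Sum>j<k. T i j (x j))"

definition direct_sum_cinner ::
    "nat \<Rightarrow> (nat \<Rightarrow> 'k::complex_hilbert_space) \<Rightarrow> (nat \<Rightarrow> 'k) \<Rightarrow> complex" where
  "direct_sum_cinner k x y = (\<Sum>i<k. cinner (x i) (y i))"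

definition positive_block_op ::
    "nat \<Rightarrow> (nat \<Rightarrow> nat \<Rightarrow> 'k::complex_hilbert_space \<Rightarrow> 'k) \<Rightarrow> bool" where
  "positive_block_op k T \<longleftrightarrow>
     (\<forall>i<k. \<forall>j<k. T i j \<in> bounded_operators) \<and>
     (\<forall>x. direct_sum_cinner k x (block_op_apply k T x) \<in> \<real>\<^sub>\<ge>\<^sub>0)"


section \<open>Complex matrices\<close>

definition psd_mat :: "nat \<Rightarrow> complex mat \<Rightarrow> bool" where
  "psd_mat m A \<longleftrightarrow>
     A \<in> carrier_mat m m \<and> (\<forall>v \<in> carrier_vec m. (A *\<^sub>v v) \<bullet>c v \<in> \<real>\<^sub>\<ge>\<^sub>0)"

definition unitary_mat :: "nat \<Rightarrow> complex mat \<Rightarrow> bool" where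
  "unitary_mat n U \<longleftrightarrow>
     U \<in> carrier_mat n n \<and> mat_adjoint U * U = 1\<^sub>m n \<and> U * mat_adjoint U = 1\<^sub>m n"

text \<open>Rows and columns of matrix units are numbered from \<open>1\<close>, as in the usual notation.\<close>

definition matrix_unit :: "nat \<Rightarrow> nat \<Rightarrow> nat \<Rightarrow> complex mat" where
  "matrix_unit n i j = mat n n (\<lambda>(a, b). if a + 1 = i \<and> b + 1 = j then 1 else 0)"

text \<open>The identification of \<open>k \<times> k\<close> matrices over \<open>n \<times> n\<close> matrices with \<open>kn \<times> kn\<close> matrices.\<close>

definition flatten_blocks :: "nat \<Rightarrow> nat \<Rightarrow> (nat \<Rightarrow> nat \<Rightarrow> complex mat) \<Rightarrow> complex mat" where
  "flatten_blocks n k A =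
     mat (k * n) (k * n) (\<lambda>(p, q). A (p div n) (q div n) $$ (p mod n, q mod n))"

definition mat_span :: "nat \<Rightarrow> complex mat set \<Rightarrow> complex mat set" where
  "mat_span n B = LinearCombinations.module.span class_ring (module_mat TYPE(complex) n n) B"


section \<open>Operator systems\<close>

definition operator_system :: "nat \<Rightarrow> complex mat set \<Rightarrow> bool" where
  "operator_system n S \<longleftrightarrow>
     VectorSpace.subspace class_ring S (module_mat TYPE(complex) n n) \<and>
     (\<forall>A \<in> S. mat_adjoint A \<in> S) \<and> 1\<^sub>m n \<in> S"

text \<open>Maps on \<open>S\<close> are total functions whose values outside \<open>S\<close> are irrelevant.\<close>

definition linear_into_operators ::
    "complex mat set \<Rightarrow> (complex mat \<Rightarrow> 'k::complex_hilbert_space \<Rightarrow> 'k) \<Rightarrow> bool" where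
  "linear_into_operators S \<Phi> \<longleftrightarrow>
     (\<forall>A \<in> S. \<Phi> A \<in> bounded_operators) \<and>
     (\<forall>A \<in> S. \<forall>B \<in> S. \<Phi> (A + B) = (\<lambda>x. \<Phi> A x + \<Phi> B x)) \<and>
     (\<forall>c. \<forall>A \<in> S. \<Phi> (c \<cdot>\<^sub>m A) = (\<lambda>x. c *\<^sub>C \<Phi> A x))"

definition unital_map ::
    "nat \<Rightarrow> (complex mat \<Rightarrow> 'k::complex_hilbert_space \<Rightarrow> 'k) \<Rightarrow> bool" where
  "unital_map n \<Phi> \<longleftrightarrow> \<Phi> (1\<^sub>m n) = id"

definition positive_map ::
    "nat \<Rightarrow> complex mat set \<Rightarrow> (complex mat \<Rightarrow> 'k::complex_hilbert_space \<Rightarrow> 'k) \<Rightarrow> bool" where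
  "positive_map n S \<Phi> \<longleftrightarrow> (\<forall>A \<in> S. psd_mat n A \<longrightarrow> positive_op (\<Phi> A))"

definition completely_positive_map ::
    "nat \<Rightarrow> complex mat set \<Rightarrow> (complex mat \<Rightarrow> 'k::complex_hilbert_space \<Rightarrow> 'k) \<Rightarrow> bool" where
  "completely_positive_map n S \<Phi> \<longleftrightarrow>
     (\<forall>k \<ge> 1. \<forall>A. (\<forall>i<k. \<forall>j<k. A i j \<in> S) \<longrightarrow> psd_mat (k * n) (flatten_blocks n k A) \<longrightarrow>
        positive_block_op k (\<lambda>i j. \<Phi> (A i j)))"

text \<open>
  HOL has no quantifier over types, so the Hilbert space is a type parameter: \<open>S\<close> is a maximal
  operator system if \<open>maximal_operator_system TYPE('k) n S\<close> holds for every type \<open>'k\<close> of class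
  \<^class>\<open>complex_hilbert_space\<close>, i.e. if it is a theorem with \<open>'k\<close> a type variable that does
  not occur in the hypotheses.
\<close>

definition maximal_operator_system ::
    "'k::complex_hilbert_space itself \<Rightarrow> nat \<Rightarrow> complex mat set \<Rightarrow> bool" where
  "maximal_operator_system (_ :: 'k itself) n S \<longleftrightarrow>
     operator_system n S \<and>
     (\<forall>\<Phi> :: complex mat \<Rightarrow> 'k \<Rightarrow> 'k.
        linear_into_operators S \<Phi> \<longrightarrow> unital_map n \<Phi> \<longrightarrow> positive_map n S \<Phi> \<longrightarrow>
        completely_positive_map n S \<Phi>)"

end

theory Submission
  imports Defs
begin

text \<open>
  After conjugating by the unitary, \<open>S\<close> consists of matrices that are block diagonal, with
  blocks of size one and symmetric blocks \<open>(a b; b c)\<close> of size two. All diagonal matrix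
  units belong to the spanning set because the identity lies in the span
  (\<open>spanning_set_pair_pattern\<close>). A positive \<open>k \<times> k\<close> matrix over such a system splits into its
  blocks, so it is enough to see that a positive map sends each block to something positive.

  A block of size one contributes \<open>P \<otimes> \<Phi>(E)\<close> with \<open>P\<close> positive semidefinite, and
  \<open>P\<close> is a sum of rank one matrices (\<open>psd_gram\<close>), so this is positive. A block of size two
  contributes \<open>A \<otimes> X + B \<otimes> Y + C \<otimes> Z\<close>, where the block matrix \<open>(A B; B C)\<close> is positive
  semidefinite with the same \<open>B\<close> in both corners, and where
  positivity of \<open>\<Phi>\<close> on the matrices \<open>(s, t)\<^sup>T (s, t)\<close> says
  \<open>s\<^sup>2 X + s t Y + t\<^sup>2 Z \<ge> 0\<close> for all real \<open>s\<close> and \<open>t\<close>. The equality of the corners forces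
  \<open>B\<close> to be Hermitian. Suppose first that \<open>C\<close> is positive definite. Then \<open>B\<close> and \<open>C\<close> can be
  diagonalised simultaneously by a congruence, \<open>C = \<Sum> N\<^sub>l N\<^sub>l\<^sup>*\<close> and
  \<open>B = \<Sum> d\<^sub>l N\<^sub>l N\<^sub>l\<^sup>*\<close> with real \<open>d\<^sub>l\<close>
  (\<open>simultaneous_diagonalisation\<close>), and the Schur complement
  \<open>G = A - B C\<^bsup>-1\<^esup> B = A - \<Sum> d\<^sub>l\<^sup>2 N\<^sub>l N\<^sub>l\<^sup>*\<close> is positive semidefinite. Hence the
  contribution equals
  \<open>G \<otimes> X + \<Sum> N\<^sub>l N\<^sub>l\<^sup>* \<otimes> (d\<^sub>l\<^sup>2 X + d\<^sub>l Y + Z)\<close>,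
  a sum of positive terms (\<open>op_form_pair_pos_def\<close>). In other words, the positive block matrix is
  a sum of elementary tensors of positive matrices. The general case
  follows on replacing \<open>C\<close> by \<open>C + \<epsilon> I\<close> and letting \<open>\<epsilon>\<close> tend to \<open>0\<close> (\<open>op_form_pair\<close>).
\<close>

section \<open>Sesquilinear forms on a finite index set\<close>

lemma cnj_mult_self_nonneg: "cnj z * z \<in> \<real>\<^sub>\<ge>\<^sub>0"
  by (simp add: complex_nonneg_Reals_iff)

lemma nonneg_Reals_sum: "(\<And>i. i \<in> I \<Longrightarrow> f i \<in> \<real>\<^sub>\<ge>\<^sub>0) \<Longrightarrow> sum f I \<in> (\<real>\<^sub>\<ge>\<^sub>0 :: complex set)"
  by (induction I rule: infinite_finite_induct) auto

text \<open>
  Square matrices and vectors are functions on an index set of arbitrary type, so that an induction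
  can remove any one index. The form is conjugate-linear in its first vector.
\<close>

definition sesq :: "'i set \<Rightarrow> ('i \<Rightarrow> 'i \<Rightarrow> complex) \<Rightarrow> ('i \<Rightarrow> complex) \<Rightarrow> ('i \<Rightarrow> complex) \<Rightarrow> complex" where
  "sesq I A v u = (\<Sum>i\<in>I. \<Sum>j\<in>I. A i j * cnj (v i) * u j)"

definition hermitian_on :: "'i set \<Rightarrow> ('i \<Rightarrow> 'i \<Rightarrow> complex) \<Rightarrow> bool" where
  "hermitian_on I A \<longleftrightarrow> (\<forall>i\<in>I. \<forall>j\<in>I. A j i = cnj (A i j))"

definition pos_def_on :: "'i set \<Rightarrow> ('i \<Rightarrow> 'i \<Rightarrow> complex) \<Rightarrow> bool" where
  "pos_def_on I C \<longleftrightarrow>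
     hermitian_on I C \<and> (\<forall>v. (\<exists>i\<in>I. v i \<noteq> 0) \<longrightarrow> 0 < Re (sesq I C v v))"

lemma hermitian_onD: "hermitian_on I A \<Longrightarrow> i \<in> I \<Longrightarrow> j \<in> I \<Longrightarrow> A j i = cnj (A i j)"
  unfolding hermitian_on_def by blast

lemma pos_def_onD: "pos_def_on I C \<Longrightarrow> i \<in> I \<Longrightarrow> v i \<noteq> 0 \<Longrightarrow> 0 < Re (sesq I C v v)"
  unfolding pos_def_on_def by blast

lemma hermitian_on_subset: "hermitian_on I A \<Longrightarrow> J \<subseteq> I \<Longrightarrow> hermitian_on J A"
  unfolding hermitian_on_def by blast

lemma sesq_alt: "sesq I A v u = (\<Sum>i\<in>I. cnj (v i) * (\<Sum>j\<in>I. A i j * u j))"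
  unfolding sesq_def by (simp add: sum_distrib_left mult_ac)

lemma sesq_cong:
  "(\<And>i j. i \<in> I \<Longrightarrow> j \<in> I \<Longrightarrow> A i j = B i j) \<Longrightarrow> (\<And>i. i \<in> I \<Longrightarrow> v i = v' i) \<Longrightarrow>
   (\<And>i. i \<in> I \<Longrightarrow> u i = u' i) \<Longrightarrow> sesq I A v u = sesq I B v' u'"
  unfolding sesq_def by (auto intro!: sum.cong)

lemma sesq_add_mat: "sesq I (\<lambda>i j. A i j + B i j) v u = sesq I A v u + sesq I B v u"
  unfolding sesq_def by (simp add: algebra_simps sum.distrib)

lemma sesq_diff_mat: "sesq I (\<lambda>i j. A i j - B i j) v u = sesq I A v u - sesq I B v u"
  unfolding sesq_def by (simp add: algebra_simps sum_subtractf)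

lemma sesq_add_left: "sesq I A (\<lambda>i. v i + v' i) u = sesq I A v u + sesq I A v' u"
  unfolding sesq_def by (simp add: algebra_simps sum.distrib)

lemma sesq_add_right: "sesq I A v (\<lambda>i. u i + u' i) = sesq I A v u + sesq I A v u'"
  unfolding sesq_def by (simp add: algebra_simps sum.distrib)

lemma sesq_scale_left: "sesq I A (\<lambda>i. a * v i) u = cnj a * sesq I A v u"
  unfolding sesq_def by (simp add: sum_distrib_left mult_ac)

lemma sesq_scale_right: "sesq I A v (\<lambda>i. a * u i) = a * sesq I A v u"
  unfolding sesq_def by (simp add: sum_distrib_left mult_ac)

lemma sesq_commute:
  assumes "hermitian_on I A"
  shows "sesq I A u v = cnj (sesq I A v u)"
proof -
  have "sesq I A u v = (\<Sum>j\<in>I. \<Sum>i\<in>I. A i j * cnj (u i) * v j)"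
    unfolding sesq_def by (rule sum.swap)
  also have "\<dots> = (\<Sum>j\<in>I. \<Sum>i\<in>I. cnj (A j i * cnj (v j) * u i))"
  proof (intro sum.cong refl)
    fix i j assume "i \<in> I" "j \<in> I"
    then have "A i j = cnj (A j i)" by (intro hermitian_onD[OF assms])
    then show "A i j * cnj (u i) * v j = cnj (A j i * cnj (v j) * u i)" by simp
  qed
  finally show ?thesis unfolding sesq_def by simp
qed

lemma sesq_real: "hermitian_on I A \<Longrightarrow> Im (sesq I A v v) = 0"
  using sesq_commute[of I A v v] by (simp add: complex_eq_iff)

lemma sesq_delta:
  assumes "finite I" "p \<in> I" "q \<in> I"
  shows "sesq I A (\<lambda>i. if i = p then 1 else 0) (\<lambda>i. if i = q then 1 else 0) = A p q"
  using assms unfolding sesq_alt by (simp add: if_distrib if_distribR cong: if_cong)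

lemma sesq_delta_scaled:
  assumes "finite I" "p \<in> I" "q \<in> I"
  shows "sesq I A (\<lambda>i. if i = p then x else 0) (\<lambda>i. if i = q then y else 0) = A p q * cnj x * y"
proof -
  have "(\<lambda>i. if i = p then x else 0) = (\<lambda>i. x * (if i = p then 1 else 0))"
    "(\<lambda>i. if i = q then y else 0) = (\<lambda>i. y * (if i = q then 1 else 0))" by auto
  then show ?thesis using sesq_delta[OF assms, of A] by (simp only: sesq_scale_left sesq_scale_right mult_ac)
qed

text \<open>
  Polarisation: the values at \<open>e\<^sub>p + z e\<^sub>q\<close> for \<open>z = 1\<close> and \<open>z = \<i>\<close> recover the
  imaginary and real parts of the difference between \<open>A q p\<close> and the conjugate of \<open>A p q\<close>.
\<close>

lemma real_form_imp_hermitian: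
  assumes I: "finite I" and re: "\<And>v. Im (sesq I A v v) = 0"
  shows "hermitian_on I A"
  unfolding hermitian_on_def
proof (intro ballI)
  fix p q assume p: "p \<in> I" and q: "q \<in> I"
  let ?d = "\<lambda>p i. if i = p then 1 else (0::complex)"
  have e: "Im (A p q * z + A q p * cnj z) = 0" for z
  proof -
    have "sesq I A (\<lambda>i. ?d p i + z * ?d q i) (\<lambda>i. ?d p i + z * ?d q i) =
      A p p + z * A p q + cnj z * A q p + cnj z * (z * A q q)"
      unfolding sesq_add_left sesq_add_right sesq_scale_left sesq_scale_right
      using sesq_delta[OF I p p] sesq_delta[OF I p q] sesq_delta[OF I q p] sesq_delta[OF I q q]
      by (simp add: algebra_simps)
    moreover have "Im (A p p) = 0" "Im (A q q) = 0"
      using re[of "?d p"] re[of "?d q"] sesq_delta[OF I p p] sesq_delta[OF I q q] by auto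
    moreover have "Im (cnj z * (z * A q q)) = 0"
      using \<open>Im (A q q) = 0\<close> by (simp add: algebra_simps)
    ultimately show ?thesis
      using re[of "\<lambda>i. ?d p i + z * ?d q i"] by (simp add: algebra_simps)
  qed
  from e[of 1] e[of \<i>] show "A q p = cnj (A p q)" by (simp add: complex_eq_iff)
qed

lemma sesq_scalar:
  "finite I \<Longrightarrow> sesq I (\<lambda>i j. if i = j then a else 0) v u = a * (\<Sum>i\<in>I. cnj (v i) * u i)"
  unfolding sesq_alt
  by (simp add: if_distrib[of "\<lambda>x. x * _"] cong: if_cong) (simp add: sum_distrib_left mult_ac)

lemma Re_sum_cnj_self: "Re (\<Sum>i\<in>I. cnj (v i) * v i) = (\<Sum>i\<in>I. (cmod (v i))\<^sup>2)"
  by (simp add: cmod_power2 sum.distrib) (simp add: power2_eq_square)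

lemma Re_sum_cnj_self_pos:
  "finite I \<Longrightarrow> s \<in> I \<Longrightarrow> v s \<noteq> 0 \<Longrightarrow> 0 < Re (\<Sum>i\<in>I. cnj (v i) * v i)"
  unfolding Re_sum_cnj_self by (intro sum_pos2[of _ s]) auto

section \<open>Eigenvectors of a Hermitian pencil\<close>

text \<open>
  Injectivity makes \<open>C\<close> invertible, and an ordinary eigenvector of \<open>C\<^bsup>-1\<^esup> B\<close>
  is an eigenvector of the pencil. One exists because characteristic polynomials split over the complex
  numbers.
\<close>

lemma pencil_eigenvector_lessThan:
  fixes B C :: "nat \<Rightarrow> nat \<Rightarrow> complex"
  assumes k: "k > 0"
    and inj: "\<And>v. (\<exists>i<k. v i \<noteq> 0) \<Longrightarrow> \<exists>i<k. (\<Sum>j<k. C i j * v j) \<noteq> 0"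
  shows "\<exists>w e. (\<exists>i<k. w i \<noteq> 0) \<and> (\<forall>i<k. (\<Sum>j<k. B i j * w j) = e * (\<Sum>j<k. C i j * w j))"
proof -
  define Cm Bm where "Cm = mat k k (\<lambda>(i, j). C i j)" and "Bm = mat k k (\<lambda>(i, j). B i j)"
  have Cm[simp]: "Cm \<in> carrier_mat k k" and Bm[simp]: "Bm \<in> carrier_mat k k"
    by (auto simp: Cm_def Bm_def)
  have Cv: "(Cm *\<^sub>v v) $ i = (\<Sum>j<k. C i j * v $ j)"
    and Bv: "(Bm *\<^sub>v v) $ i = (\<Sum>j<k. B i j * v $ j)" if "v \<in> carrier_vec k" "i < k" for v i
    using that by (auto simp: Cm_def Bm_def scalar_prod_def atLeast0LessThan)
  have "det Cm \<noteq> 0"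
  proof
    assume "det Cm = 0"
    then obtain v where v: "v \<in> carrier_vec k" "v \<noteq> 0\<^sub>v k" "Cm *\<^sub>v v = 0\<^sub>v k"
      using det_0_iff_vec_prod_zero[OF Cm] by blast
    from v(1,2) have "\<exists>i<k. v $ i \<noteq> 0" by (auto intro: eq_vecI)
    from inj[OF this] obtain i where "i < k" "(\<Sum>j<k. C i j * v $ j) \<noteq> 0" by blast
    with Cv[OF v(1)] v(3) show False by simp
  qed
  from det_non_zero_imp_unit[OF Cm this, of "()"]
  obtain Ci where Ci[simp]: "Ci \<in> carrier_mat k k" and inv: "Cm * Ci = 1\<^sub>m k"
    unfolding Units_def by (auto simp: ring_mat_simps)
  have T: "Ci * Bm \<in> carrier_mat k k" by (rule mult_carrier_mat[OF Ci Bm])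
  obtain as where as: "char_poly (Ci * Bm) = (\<Prod>a\<leftarrow>as. [:- a, 1:])" "length as = k"
    using char_poly_factorized[OF T] by blast
  with k obtain e where "e \<in> set as" by (cases as) auto
  then have "poly (char_poly (Ci * Bm)) e = 0"
    unfolding as(1) poly_prod_list prod_list_zero_iff by force
  then obtain w where w: "w \<in> carrier_vec k" "w \<noteq> 0\<^sub>v k" "Ci * Bm *\<^sub>v w = e \<cdot>\<^sub>v w"
    using eigenvalue_root_char_poly[OF T] carrier_matD(1)[OF T]
    unfolding eigenvalue_def eigenvector_def by metis
  have "Bm *\<^sub>v w = (Cm * Ci) *\<^sub>v (Bm *\<^sub>v w)"
    unfolding inv using mult_mat_vec_carrier[OF Bm w(1)] by (simp only: one_mult_mat_vec)
  also have "\<dots> = Cm *\<^sub>v (Ci *\<^sub>v (Bm *\<^sub>v w))"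
    by (rule assoc_mult_mat_vec[OF Cm Ci mult_mat_vec_carrier[OF Bm w(1)]])
  also have "Ci *\<^sub>v (Bm *\<^sub>v w) = Ci * Bm *\<^sub>v w"
    using w(1) by (intro assoc_mult_mat_vec[OF Ci Bm, symmetric])
  also have "Cm *\<^sub>v (Ci * Bm *\<^sub>v w) = e \<cdot>\<^sub>v (Cm *\<^sub>v w)"
    unfolding w(3) using w(1) by (intro mult_mat_vec[OF Cm])
  finally have eq: "Bm *\<^sub>v w = e \<cdot>\<^sub>v (Cm *\<^sub>v w)" .
  show ?thesis
  proof (intro exI[of _ "\<lambda>i. w $ i"] exI[of _ e] conjI allI impI)
    show "\<exists>i<k. w $ i \<noteq> 0" using w(1,2) by (auto intro: eq_vecI)
    fix i assume i: "i < k"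
    from arg_cong[OF eq, of "\<lambda>v. v $ i"] 
    show "(\<Sum>j<k. B i j * w $ j) = e * (\<Sum>j<k. C i j * w $ j)"
      using i w(1) Bv[OF w(1) i] Cv[OF w(1) i] by (simp add: Cm_def)
  qed
qed

text \<open>
  The eigenvalue is real because it is the quotient of the real numbers \<open>w\<^sup>* B w\<close> and
  \<open>w\<^sup>* C w\<close>. The matrix \<open>C\<close> serves as the inner product, so \<open>w\<close> is normalised with respect to it.
\<close>

lemma pencil_eigenvector:
  assumes I: "finite I" "I \<noteq> {}" and C: "pos_def_on I C" and B: "hermitian_on I B"
  shows "\<exists>w (e::real). sesq I C w w = 1 \<and>
           (\<forall>i\<in>I. (\<Sum>j\<in>I. B i j * w j) = of_real e * (\<Sum>j\<in>I. C i j * w j))"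
proof -
  obtain h where h: "bij_betw h {..<card I} I"
    using ex_bij_betw_nat_finite[OF I(1)] by (auto simp: atLeast0LessThan)
  define g where "g = inv_into {..<card I} h"
  have hI: "h a \<in> I" if "a < card I" for a using h that by (auto simp: bij_betw_def)
  have gh: "g (h a) = a" if "a < card I" for a
    using h that by (auto simp: g_def bij_betw_def)
  have hg: "h (g i) = i" "g i < card I" if "i \<in> I" for i
    using f_inv_into_f[of i h "{..<card I}"] inv_into_into[of i h "{..<card I}"] h that
    unfolding g_def bij_betw_def by auto
  have re: "(\<Sum>j\<in>I. f j) = (\<Sum>b<card I. f (h b))" for f :: "'a \<Rightarrow> complex"
    by (rule sum.reindex_bij_betw[OF h, symmetric])
  have "\<exists>w e. (\<exists>a<card I. w a \<noteq> 0) \<and> (\<forall>a<card I.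
      (\<Sum>b<card I. B (h a) (h b) * w b) = e * (\<Sum>b<card I. C (h a) (h b) * w b))"
  proof (rule pencil_eigenvector_lessThan)
    show "card I > 0" using I by (simp add: card_gt_0_iff)
    fix v :: "nat \<Rightarrow> complex" assume "\<exists>a<card I. v a \<noteq> 0"
    then obtain a where "a < card I" "v a \<noteq> 0" by blast
    then have "0 < Re (sesq I C (\<lambda>i. v (g i)) (\<lambda>i. v (g i)))"
      by (intro pos_def_onD[OF C, of "h a"]) (simp_all add: hI gh)
    then have "sesq I C (\<lambda>i. v (g i)) (\<lambda>i. v (g i)) \<noteq> 0" by auto
    then have "\<exists>i\<in>I. (\<Sum>j\<in>I. C i j * v (g j)) \<noteq> 0"
      unfolding sesq_alt using sum.neutral by (metis (no_types, lifting) mult_zero_right)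
    then obtain i where "i \<in> I" "(\<Sum>b<card I. C i (h b) * v (g (h b))) \<noteq> 0"
      unfolding re by blast
    then show "\<exists>a<card I. (\<Sum>b<card I. C (h a) (h b) * v b) \<noteq> 0"
      using gh hg by (intro exI[of _ "g i"]) auto
  qed
  then obtain w0 e where w0: "\<exists>a<card I. w0 a \<noteq> 0" and ev: "\<And>a. a < card I \<Longrightarrow>
      (\<Sum>b<card I. B (h a) (h b) * w0 b) = e * (\<Sum>b<card I. C (h a) (h b) * w0 b)" by blast
  define w where "w = w0 \<circ> g"
  have w: "\<exists>i\<in>I. w i \<noteq> 0" using w0 hI gh unfolding w_def comp_def by metis
  have ev': "(\<Sum>j\<in>I. B i j * w j) = e * (\<Sum>j\<in>I. C i j * w j)" if "i \<in> I" for i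
    using ev[OF hg(2)[OF that]] hg(1)[OF that] gh unfolding re w_def by simp
  define s where "s = Re (sesq I C w w)"
  have s: "s > 0" "sesq I C w w = of_real s"
    using w pos_def_onD[OF C] sesq_real[of I C w] C unfolding s_def pos_def_on_def
    by (blast, simp add: complex_eq_iff)
  have "sesq I B w w = e * sesq I C w w"
    unfolding sesq_alt sum_distrib_left[of e] by (rule sum.cong) (simp_all add: ev' mult.left_commute)
  then have "Im e = 0" using sesq_real[OF B, of w] s by simp
  then have e: "e = of_real (Re e)" by (simp add: complex_eq_iff)
  define t where "t = complex_of_real (1 / sqrt s)"
  have t: "cnj t * (t * of_real s) = 1"
    using s(1) unfolding t_def by (simp flip: of_real_mult)
  show ?thesis
  proof (intro exI[of _ "\<lambda>i. t * w i"] exI[of _ "Re e"] conjI ballI)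
    show "sesq I C (\<lambda>i. t * w i) (\<lambda>i. t * w i) = 1"
      unfolding sesq_scale_left sesq_scale_right s(2) by (rule t)
    fix i assume i: "i \<in> I"
    have "(\<Sum>j\<in>I. M i j * (t * w j)) = t * (\<Sum>j\<in>I. M i j * w j)" for M :: "'a \<Rightarrow> 'a \<Rightarrow> complex"
      by (simp add: sum_distrib_left mult_ac)
    then show "(\<Sum>j\<in>I. B i j * (t * w j)) = of_real (Re e) * (\<Sum>j\<in>I. C i j * (t * w j))"
      using ev'[OF i] by (simp add: mult_ac flip: e)
  qed
qed

section \<open>Simultaneous diagonalisation of two Hermitian forms\<close>

text \<open>
  If \<open>w r \<noteq> 0\<close>, a Hermitian matrix that annihilates \<open>w\<close> is determined by its entries off row
  and column \<open>r\<close>: the equation \<open>M w = 0\<close> recovers the rest of column \<open>r\<close>, symmetry the rest of row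
  \<open>r\<close>, and the equation once more the entry at \<open>(r, r)\<close>.
  This is what lets the induction for \<open>simultaneous_diagonalisation\<close> drop one index.
\<close>

lemma hermitian_eqI_kernel:
  assumes I: "finite I" "r \<in> I" and w: "w r \<noteq> 0"
    and M: "hermitian_on I M" "\<And>i. i \<in> I \<Longrightarrow> (\<Sum>j\<in>I. M i j * w j) = 0"
    and M': "hermitian_on I M'" "\<And>i. i \<in> I \<Longrightarrow> (\<Sum>j\<in>I. M' i j * w j) = 0"
    and eq: "\<And>i j. i \<in> I - {r} \<Longrightarrow> j \<in> I - {r} \<Longrightarrow> M i j = M' i j"
    and ij: "i \<in> I" "j \<in> I"
  shows "M i j = M' i j"
proof -
  define D where "D i j = M i j - M' i j" for i j
  have D0: "D i j = 0" if "i \<in> I - {r}" "j \<in> I - {r}" for i j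
    using eq[OF that] by (simp add: D_def)
  have Dw: "(\<Sum>j\<in>I. D i j * w j) = 0" if "i \<in> I" for i
    using M(2)[OF that] M'(2)[OF that] by (simp add: D_def left_diff_distrib sum_subtractf)
  have Dh: "D j i = cnj (D i j)" if "i \<in> I" "j \<in> I" for i j
    using hermitian_onD[OF M(1) that] hermitian_onD[OF M'(1) that] by (simp add: D_def)
  have col: "D i r = 0" if i: "i \<in> I - {r}" for i
  proof -
    have "(\<Sum>j\<in>I. D i j * w j) = D i r * w r + (\<Sum>j\<in>I - {r}. D i j * w j)"
      by (rule sum.remove[OF I])
    also have "(\<Sum>j\<in>I - {r}. D i j * w j) = 0"
      by (rule sum.neutral) (simp add: D0[OF i])
    finally show ?thesis using Dw[of i] i w by simp
  qed
  have row: "D r j = 0" if "j \<in> I - {r}" for j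
    using Dh[of j r] col[OF that] that I(2) by simp
  have "(\<Sum>j\<in>I. D r j * w j) = D r r * w r + (\<Sum>j\<in>I - {r}. D r j * w j)"
    by (rule sum.remove[OF I])
  also have "(\<Sum>j\<in>I - {r}. D r j * w j) = 0"
    by (rule sum.neutral) (simp add: row)
  finally have "D r r = 0" using Dw[OF I(2)] w by simp
  with D0 col row ij have "D i j = 0" by (cases "i = r"; cases "j = r") auto
  then show ?thesis by (simp add: D_def)
qed

text \<open>
  The matrix \<open>\<Sum> d\<^sub>l N\<^sub>l N\<^sub>l\<^sup>*\<close> for the vectors \<open>N\<^sub>l = N l\<close>, i.e. the congruence
  transform of a diagonal matrix.
\<close>

definition diag_form :: "'i set \<Rightarrow> ('i \<Rightarrow> complex) \<Rightarrow> ('i \<Rightarrow> 'i \<Rightarrow> complex) \<Rightarrow> 'i \<Rightarrow> 'i \<Rightarrow> complex" where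
  "diag_form L d N i j = (\<Sum>l\<in>L. d l * N l i * cnj (N l j))"

lemma hermitian_diag_form:
  "(\<And>l. l \<in> L \<Longrightarrow> Im (d l) = 0) \<Longrightarrow> hermitian_on I (diag_form L d N)"
  unfolding hermitian_on_def diag_form_def cnj_sum
  by (intro ballI sum.cong refl) (simp add: complex_eq_iff mult_ac)

lemma diag_form_kernel:
  assumes "\<And>l. l \<in> L \<Longrightarrow> (\<Sum>j\<in>I. cnj (N l j) * w j) = 0"
  shows "(\<Sum>j\<in>I. diag_form L d N i j * w j) = 0"
proof -
  have "(\<Sum>j\<in>I. diag_form L d N i j * w j) = (\<Sum>l\<in>L. d l * N l i * (\<Sum>j\<in>I. cnj (N l j) * w j))"
    unfolding diag_form_def sum_distrib_left sum_distrib_right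
    by (subst sum.swap) (simp add: mult_ac)
  with assms show ?thesis by simp
qed

lemma sesq_diag_form:
  "sesq I (diag_form L d N) v u =
     (\<Sum>l\<in>L. d l * cnj (\<Sum>i\<in>I. cnj (N l i) * v i) * (\<Sum>j\<in>I. cnj (N l j) * u j))"
proof -
  have "sesq I (diag_form L d N) v u =
    (\<Sum>i\<in>I. \<Sum>j\<in>I. \<Sum>l\<in>L. d l * (N l i * cnj (v i)) * (cnj (N l j) * u j))"
    unfolding sesq_def diag_form_def by (simp add: sum_distrib_left sum_distrib_right mult_ac)
  also have "\<dots> = (\<Sum>l\<in>L. \<Sum>i\<in>I. \<Sum>j\<in>I. d l * (N l i * cnj (v i)) * (cnj (N l j) * u j))"
    by (subst sum.swap[of _ L]) (subst sum.swap[of _ L], simp)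
  also have "\<dots> = (\<Sum>l\<in>L. d l * (\<Sum>i\<in>I. N l i * cnj (v i)) * (\<Sum>j\<in>I. cnj (N l j) * u j))"
    by (simp add: sum_distrib_left sum_distrib_right mult_ac)
  finally show ?thesis by simp
qed

text \<open>
  Deflation. Let \<open>w\<close> be an eigenvector of the pencil with \<open>w\<^sup>* C w = 1\<close> and real eigenvalue \<open>e\<close>, and
  put \<open>c = C w\<close>. Then \<open>C - c c\<^sup>*\<close> and \<open>B - e c c\<^sup>*\<close> annihilate \<open>w\<close>, so
  they are determined by their restrictions to the indices other than some \<open>r\<close> with \<open>w r \<noteq> 0\<close>. On
  these the first matrix is still positive definite, and the induction hypothesis applies.

  The vectors \<open>R m\<close> form the basis dual to the vectors \<open>N l\<close>. With them the numbers \<open>N\<^sub>l\<^sup>* u\<close>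
  can be prescribed at will by the choice of \<open>u\<close>, which replaces the inverse of \<open>C\<close> in
  the Schur complement.
\<close>

lemma simultaneous_diagonalisation:
  assumes "finite I" and "pos_def_on I C" and "hermitian_on I B"
  shows "\<exists>N (d :: 'i \<Rightarrow> real) R.
    (\<forall>i\<in>I. \<forall>j\<in>I. C i j = diag_form I (\<lambda>_. 1) N i j) \<and>
    (\<forall>i\<in>I. \<forall>j\<in>I. B i j = diag_form I (\<lambda>l. of_real (d l)) N i j) \<and>
    (\<forall>l\<in>I. \<forall>m\<in>I. (\<Sum>i\<in>I. cnj (N l i) * R m i) = (if l = m then 1 else 0))"
  using assms
proof (induction "card I" arbitrary: I B C)
  case 0
  then show ?case by simp
next
  case (Suc n)
  note I = \<open>finite I\<close> and C = \<open>pos_def_on I C\<close> and B = \<open>hermitian_on I B\<close>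
  have Ch: "hermitian_on I C" using C by (simp add: pos_def_on_def)
  have "I \<noteq> {}" using Suc.hyps(2) by auto
  then obtain w e where w1: "sesq I C w w = 1"
    and ev: "\<And>i. i \<in> I \<Longrightarrow> (\<Sum>j\<in>I. B i j * w j) = of_real e * (\<Sum>j\<in>I. C i j * w j)"
    using pencil_eigenvector[OF I _ C B] by blast
  have "\<exists>r\<in>I. w r \<noteq> 0"
  proof (rule ccontr)
    assume "\<not> ?thesis"
    then have "sesq I C w w = 0" unfolding sesq_alt by simp
    with w1 show False by simp
  qed
  then obtain r where r: "r \<in> I" "w r \<noteq> 0" by blast
  define I' where "I' = I - {r}"
  have I': "finite I'" "n = card I'" using I r Suc.hyps(2) by (auto simp: I'_def)
  define c where "c i = (\<Sum>j\<in>I. C i j * w j)" for i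
  have cw: "(\<Sum>j\<in>I. cnj (c j) * w j) = 1"
    using arg_cong[OF w1, of cnj] unfolding sesq_alt c_def[symmetric] by (simp add: mult.commute)
  define C1 B1 where "C1 i j = C i j - c i * cnj (c j)"
    and "B1 i j = B i j - of_real e * (c i * cnj (c j))" for i j
  have h1: "hermitian_on I C1" "hermitian_on I B1"
  proof -
    have "C1 j i = cnj (C1 i j)" "B1 j i = cnj (B1 i j)" if ij: "i \<in> I" "j \<in> I" for i j
      unfolding C1_def B1_def hermitian_onD[OF Ch ij] hermitian_onD[OF B ij] by simp_all
    then show "hermitian_on I C1" "hermitian_on I B1" unfolding hermitian_on_def by blast+
  qed
  have c_out: "(\<Sum>j\<in>I. c i * cnj (c j) * w j) = c i" for i
    using cw by (simp add: mult.assoc flip: sum_distrib_left)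
  have k1: "(\<Sum>j\<in>I. C1 i j * w j) = 0" "(\<Sum>j\<in>I. B1 i j * w j) = 0" if "i \<in> I" for i
    using c_out[of i] ev[OF that]
    by (simp_all add: C1_def B1_def left_diff_distrib sum_subtractf c_def[symmetric] mult.assoc
        flip: sum_distrib_left)
  have Cw: "sesq I C v w = (\<Sum>j\<in>I. cnj (v j) * c j)" for v
    unfolding sesq_alt c_def ..
  have ext: "sesq I' M v v = sesq I M (\<lambda>i. if i = r then 0 else v i) (\<lambda>i. if i = r then 0 else v i)"
    for M v
    unfolding sesq_alt I'_def sum.remove[OF I r(1)] by (auto intro!: sum.cong)
  have pd: "pos_def_on I' C1"
    unfolding pos_def_on_def
  proof (intro conjI allI impI)
    show "hermitian_on I' C1" using hermitian_on_subset[OF h1(1)] by (auto simp: I'_def)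
    fix v :: "_ \<Rightarrow> complex" assume "\<exists>i\<in>I'. v i \<noteq> 0"
    then obtain s where s: "s \<in> I" "s \<noteq> r" "v s \<noteq> 0" by (auto simp: I'_def)
    define v' where "v' i = (if i = r then 0 else v i)" for i
    define a where "a = (\<Sum>j\<in>I. cnj (c j) * v' j)"
    \<comment> \<open>Removing the component along \<open>w\<close> leaves the form of \<open>C1\<close> unchanged, and on the remainder \<open>z\<close> it
      agrees with that of \<open>C\<close>.\<close>
    define z where "z i = v' i + (- a) * w i" for i
    have "sesq I C v' w = cnj a" unfolding Cw a_def by (simp add: mult.commute)
    moreover from this have "sesq I C w v' = a" using sesq_commute[OF Ch, of w v'] by simp
    ultimately have zz: "sesq I C z z = sesq I C v' v' - cnj a * a"
      unfolding z_def sesq_add_left sesq_add_right sesq_scale_left sesq_scale_right w1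
      by (simp add: algebra_simps)
    have "sesq I (\<lambda>i j. c i * cnj (c j)) v' v' = cnj a * a"
      using sesq_diag_form[of I "{r}" "\<lambda>_. 1" "\<lambda>_. c" v' v']
      by (simp add: diag_form_def[abs_def] a_def)
    then have "sesq I C1 v' v' = sesq I C z z"
      unfolding C1_def[abs_def] sesq_diff_mat zz by simp
    moreover have "\<exists>i\<in>I. z i \<noteq> 0"
    proof (cases "a = 0")
      case True
      then show ?thesis using s by (auto simp: z_def v'_def)
    next
      case False
      then show ?thesis using r by (auto simp: z_def v'_def)
    qed
    ultimately show "0 < Re (sesq I' C1 v v)"
      using C unfolding ext[of C1 v] v'_def[symmetric] pos_def_on_def by auto
  qed
  have hB1: "hermitian_on I' B1" using hermitian_on_subset[OF h1(2)] by (auto simp: I'_def)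
  from Suc.hyps(1)[OF I'(2) I'(1) pd hB1] obtain N' R' and d' :: "'i \<Rightarrow> real" where IH:
    "\<forall>i\<in>I'. \<forall>j\<in>I'. C1 i j = diag_form I' (\<lambda>_. 1) N' i j"
    "\<forall>i\<in>I'. \<forall>j\<in>I'. B1 i j = diag_form I' (\<lambda>l. of_real (d' l)) N' i j"
    "\<forall>l\<in>I'. \<forall>m\<in>I'. (\<Sum>i\<in>I'. cnj (N' l i) * R' m i) = (if l = m then 1 else 0)"
    by blast
  have IHC: "C1 i j = diag_form I' (\<lambda>_. 1) N' i j"
    and IHB: "B1 i j = diag_form I' (\<lambda>l. of_real (d' l)) N' i j"
    and IHR: "(\<Sum>m\<in>I'. cnj (N' i m) * R' j m) = (if i = j then 1 else 0)"
    if "i \<in> I'" "j \<in> I'" for i j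
    using IH that by blast+
  \<comment> \<open>The vector with index \<open>r\<close> is \<open>c\<close>, and its dual vector is \<open>w\<close>. The other vectors come from the
    induction hypothesis, with the entry at \<open>r\<close> chosen so that \<open>w\<close> is orthogonal to them. Their dual vectors
    get the entry \<open>0\<close> at \<open>r\<close> and are then corrected by a multiple of \<open>w\<close> to become orthogonal to \<open>c\<close>.\<close>
  define N where "N l i = (if l = r then c i else if i = r
      then - (\<Sum>j\<in>I'. N' l j * cnj (w j)) / cnj (w r) else N' l i)" for l i
  define R0 where "R0 m i = (if i = r then 0 else R' m i)" for m i
  define R where "R m i = (if m = r then w i else R0 m i - (\<Sum>j\<in>I. cnj (c j) * R0 m j) * w i)" for m i
  define d where "d l = (if l = r then e else d' l)" for l
  have Nw: "(\<Sum>j\<in>I. cnj (N l j) * w j) = 0" if "l \<in> I'" for l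
  proof -
    have l: "l \<noteq> r" using that by (auto simp: I'_def)
    have "(\<Sum>j\<in>I. cnj (N l j) * w j) = cnj (N l r) * w r + (\<Sum>j\<in>I'. cnj (N l j) * w j)"
      unfolding I'_def by (rule sum.remove[OF I r(1)])
    also have "(\<Sum>j\<in>I'. cnj (N l j) * w j) = (\<Sum>j\<in>I'. cnj (N' l j) * w j)"
      using l by (intro sum.cong) (auto simp: N_def I'_def)
    also have "cnj (N l r) * w r = - \<dots>"
      using l r(2) by (simp add: N_def)
    finally show ?thesis by simp
  qed
  have split: "diag_form I g N i j = g r * c i * cnj (c j) + diag_form I' g N i j" for g i j
    unfolding diag_form_def sum.remove[OF I r(1)] I'_def by (simp add: N_def)
  have N': "diag_form I' g N i j = diag_form I' g N' i j" if "i \<in> I'" "j \<in> I'" for g i j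
    using that unfolding diag_form_def by (intro sum.cong) (auto simp: N_def I'_def)
  have C1: "C1 i j = diag_form I' (\<lambda>_. 1) N i j" if "i \<in> I" "j \<in> I" for i j
    by (rule hermitian_eqI_kernel[where w = w, OF I r(1) r(2) h1(1) k1(1) hermitian_diag_form
          diag_form_kernel[OF Nw] _ that])
       (simp_all add: N' IHC I'_def[symmetric])
  have B1: "B1 i j = diag_form I' (\<lambda>l. of_real (d l)) N i j" if "i \<in> I" "j \<in> I" for i j
  proof (rule hermitian_eqI_kernel[where w = w, OF I r(1) r(2) h1(2) k1(2) hermitian_diag_form
          diag_form_kernel[OF Nw] _ that])
    fix i j assume "i \<in> I - {r}" "j \<in> I - {r}"
    then have ij: "i \<in> I'" "j \<in> I'" by (auto simp: I'_def)
    show "B1 i j = diag_form I' (\<lambda>l. of_real (d l)) N i j"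
      unfolding IHB[OF ij] N'[OF ij] unfolding diag_form_def
      by (intro sum.cong) (auto simp: d_def I'_def)
  qed simp_all
  have dual: "(\<Sum>i\<in>I. cnj (N l i) * R m i) = (if l = m then 1 else 0)"
    if l: "l \<in> I" and m: "m \<in> I" for l m
  proof (cases "m = r")
    case True
    then show ?thesis using cw Nw[of l] l by (auto simp: R_def N_def I'_def)
  next
    case False
    have "(\<Sum>i\<in>I. cnj (N l i) * (R0 m i - b * w i)) =
      (\<Sum>i\<in>I. cnj (N l i) * R0 m i) - b * (\<Sum>i\<in>I. cnj (N l i) * w i)" for b
      by (simp add: right_diff_distrib sum_subtractf sum_distrib_left mult_ac)
    then have "(\<Sum>i\<in>I. cnj (N l i) * R m i) =
      (\<Sum>i\<in>I. cnj (N l i) * R0 m i) - (\<Sum>j\<in>I. cnj (c j) * R0 m j) * (\<Sum>i\<in>I. cnj (N l i) * w i)"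
      using False by (simp only: R_def if_False)
    also have "\<dots> = (if l = m then 1 else 0)"
    proof (cases "l = r")
      case True
      then show ?thesis using cw False by (simp add: N_def)
    next
      case lr: False
      with l m False have l': "l \<in> I'" "m \<in> I'" by (auto simp: I'_def)
      have "(\<Sum>i\<in>I. cnj (N l i) * R0 m i) = (\<Sum>i\<in>I'. cnj (N l i) * R0 m i)"
        unfolding sum.remove[OF I r(1)] I'_def by (simp add: R0_def)
      also have "\<dots> = (\<Sum>i\<in>I'. cnj (N' l i) * R' m i)"
        using lr by (intro sum.cong) (auto simp: N_def R0_def I'_def)
      finally show ?thesis using IHR[OF l'] Nw[OF l'(1)] by simp
    qed
    finally show ?thesis .
  qed
  show ?case
  proof (rule exI[of _ N], rule exI[of _ d], rule exI[of _ R], intro conjI ballI)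
    fix i j assume ij: "i \<in> I" "j \<in> I"
    show "C i j = diag_form I (\<lambda>_. 1) N i j"
      unfolding split C1[OF ij, symmetric] by (simp add: C1_def)
    show "B i j = diag_form I (\<lambda>l. of_real (d l)) N i j"
      unfolding split B1[OF ij, symmetric] by (simp add: B1_def d_def)
  qed (rule dual)
qed

text \<open>
  Diagonalise the matrix simultaneously with the identity. The dual basis exhibits each \<open>d m\<close> as a value
  of the form, which is why it is nonnegative.
\<close>

lemma psd_gram:
  assumes I: "finite I" and psd: "\<And>v. sesq I A v v \<in> \<real>\<^sub>\<ge>\<^sub>0"
  shows "\<exists>N d. (\<forall>l\<in>I. 0 \<le> (d l :: real)) \<and>
           (\<forall>i\<in>I. \<forall>j\<in>I. A i j = diag_form I (\<lambda>l. of_real (d l)) N i j)"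
proof -
  have hA: "hermitian_on I A"
    using psd by (intro real_form_imp_hermitian[OF I]) (simp add: complex_nonneg_Reals_iff)
  have pd: "pos_def_on I (\<lambda>i j. if i = j then 1 else 0)"
    unfolding pos_def_on_def
  proof (intro conjI allI impI)
    show "hermitian_on I (\<lambda>i j. if i = j then 1 else (0::complex))"
      by (auto simp: hermitian_on_def)
    fix v :: "'a \<Rightarrow> complex" assume "\<exists>i\<in>I. v i \<noteq> 0"
    then obtain s where s: "s \<in> I" "v s \<noteq> 0" by blast
    then show "0 < Re (sesq I (\<lambda>i j. if i = j then 1 else 0) v v)"
      unfolding sesq_scalar[OF I] using Re_sum_cnj_self_pos[OF I, of s v] by simp
  qed
  from simultaneous_diagonalisation[OF I pd hA] obtain N R and d :: "'a \<Rightarrow> real"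
    where A: "\<forall>i\<in>I. \<forall>j\<in>I. A i j = diag_form I (\<lambda>l. of_real (d l)) N i j"
      and dual: "\<forall>l\<in>I. \<forall>m\<in>I. (\<Sum>i\<in>I. cnj (N l i) * R m i) = (if l = m then 1 else 0)"
    by blast
  have "0 \<le> d m" if m: "m \<in> I" for m
  proof -
    have "sesq I A (R m) (R m) = sesq I (diag_form I (\<lambda>l. of_real (d l)) N) (R m) (R m)"
      using A by (intro sesq_cong) auto
    also have "\<dots> = (\<Sum>l\<in>I. if l = m then of_real (d l) else 0)"
      unfolding sesq_diag_form using dual m by (intro sum.cong) auto
    also have "\<dots> = of_real (d m)" using I m by simp
    finally show ?thesis using psd[of "R m"] by simp
  qed
  with A show ?thesis by blast
qed

section \<open>Matrices of operators on a Hilbert space\<close>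

lemma cinner_scale_left: "cinner (a *\<^sub>C x) y = cnj a * cinner x y"
proof -
  have "cinner (a *\<^sub>C x) y = cnj (cinner y (a *\<^sub>C x))" by (rule cinner_commute)
  also have "\<dots> = cnj a * cnj (cinner y x)" by (simp add: cinner_scale_right)
  also have "cnj (cinner y x) = cinner x y" by (rule cinner_commute[symmetric])
  finally show ?thesis .
qed

lemma cinner_add_left: "cinner (x + y) z = cinner x z + cinner y z"
proof -
  have "cinner (x + y) z = cnj (cinner z (x + y))" by (rule cinner_commute)
  also have "\<dots> = cnj (cinner z x) + cnj (cinner z y)" by (simp add: cinner_add_right)
  also have "cnj (cinner z x) = cinner x z" by (rule cinner_commute[symmetric])
  also have "cnj (cinner z y) = cinner y z" by (rule cinner_commute[symmetric])
  finally show ?thesis .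
qed

lemma cinner_zero_right: "cinner x 0 = 0"
  using cinner_add_right[of x 0 0] by simp

lemma cinner_zero_left: "cinner 0 x = 0"
  using cinner_add_left[of 0 0 x] by simp

lemma cinner_sum_right: "cinner x (sum f I) = (\<Sum>i\<in>I. cinner x (f i))"
  by (induction I rule: infinite_finite_induct) (auto simp: cinner_zero_right cinner_add_right)

lemma cinner_sum_left: "cinner (sum f I) x = (\<Sum>i\<in>I. cinner (f i) x)"
  by (induction I rule: infinite_finite_induct) (auto simp: cinner_zero_left cinner_add_left)

lemma bounded_operators_sum_scale:
  assumes "X \<in> bounded_operators"
  shows "X (\<Sum>i\<in>I. c i *\<^sub>C x i) = (\<Sum>i\<in>I. c i *\<^sub>C X (x i))"
proof -
  have lin: "linear X" and sc: "\<And>c x. X (c *\<^sub>C x) = c *\<^sub>C X x"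
    using assms unfolding bounded_operators_def by (auto dest: bounded_linear.linear)
  show ?thesis unfolding linear_sum[OF lin] sc ..
qed

text \<open>
  The quadratic form at \<open>x\<close> of the operator matrix \<open>P \<otimes> X\<close>, whose entries are the operators \<open>P i j\<close>
  times \<open>X\<close>.
\<close>

definition op_form ::
    "'i set \<Rightarrow> ('i \<Rightarrow> 'i \<Rightarrow> complex) \<Rightarrow> ('k::complex_hilbert_space \<Rightarrow> 'k) \<Rightarrow> ('i \<Rightarrow> 'k) \<Rightarrow> complex" where
  "op_form I P X x = (\<Sum>i\<in>I. \<Sum>j\<in>I. P i j * cinner (x i) (X (x j)))"

lemma op_form_cong:
  "(\<And>i j. i \<in> I \<Longrightarrow> j \<in> I \<Longrightarrow> P i j = Q i j) \<Longrightarrow> op_form I P X x = op_form I Q X x"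
  unfolding op_form_def by (auto intro!: sum.cong)

lemma op_form_add: "op_form I (\<lambda>i j. P i j + Q i j) X x = op_form I P X x + op_form I Q X x"
  unfolding op_form_def by (simp add: algebra_simps sum.distrib)

lemma op_form_diag_form:
  assumes X: "X \<in> bounded_operators"
  shows "op_form I (diag_form L d N) X x =
    (\<Sum>l\<in>L. d l * cinner (\<Sum>j\<in>I. cnj (N l j) *\<^sub>C x j) (X (\<Sum>j\<in>I. cnj (N l j) *\<^sub>C x j)))"
proof -
  have "op_form I (diag_form L d N) X x =
    (\<Sum>i\<in>I. \<Sum>j\<in>I. \<Sum>l\<in>L. d l * (N l i * (cnj (N l j) * cinner (x i) (X (x j)))))"
    unfolding op_form_def diag_form_def by (simp add: sum_distrib_left sum_distrib_right mult_ac)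
  also have "\<dots> = (\<Sum>l\<in>L. \<Sum>i\<in>I. \<Sum>j\<in>I. d l * (N l i * (cnj (N l j) * cinner (x i) (X (x j)))))"
    by (subst sum.swap[of _ L]) (subst sum.swap[of _ L], simp)
  also have "\<dots> = (\<Sum>l\<in>L. \<Sum>j\<in>I. \<Sum>i\<in>I. d l * (cnj (N l j) * (N l i * cinner (x i) (X (x j)))))"
    by (rule sum.cong[OF refl], subst sum.swap) (simp add: mult.left_commute)
  also have "\<dots> = (\<Sum>l\<in>L. d l * cinner (\<Sum>j\<in>I. cnj (N l j) *\<^sub>C x j) (X (\<Sum>j\<in>I. cnj (N l j) *\<^sub>C x j)))"
    by (simp add: bounded_operators_sum_scale[OF X] cinner_sum_left cinner_sum_right
        cinner_scale_left cinner_scale_right sum_distrib_left)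
  finally show ?thesis .
qed

lemma op_form_psd:
  assumes I: "finite I" and psd: "\<And>v. sesq I P v v \<in> \<real>\<^sub>\<ge>\<^sub>0"
    and X: "X \<in> bounded_operators" "\<And>x. cinner x (X x) \<in> \<real>\<^sub>\<ge>\<^sub>0"
  shows "op_form I P X x \<in> \<real>\<^sub>\<ge>\<^sub>0"
proof -
  from psd_gram[OF I psd] obtain N and d :: "'a \<Rightarrow> real" where d: "\<forall>l\<in>I. 0 \<le> d l"
    and P: "\<forall>i\<in>I. \<forall>j\<in>I. P i j = diag_form I (\<lambda>l. of_real (d l)) N i j" by blast
  have "op_form I P X x = op_form I (diag_form I (\<lambda>l. of_real (d l)) N) X x"
    using P by (intro op_form_cong) blast
  also have "\<dots> \<in> \<real>\<^sub>\<ge>\<^sub>0"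
    unfolding op_form_diag_form[OF X(1)] using d
    by (intro nonneg_Reals_sum nonneg_Reals_mult_I X(2)) simp
  finally show ?thesis .
qed

text \<open>
  The heart of the argument. Writing \<open>D = \<Sum> d\<^sub>l\<^sup>2 N\<^sub>l N\<^sub>l\<^sup>*\<close>, which is \<open>B C\<^bsup>-1\<^esup> B\<close>,
  the block matrix \<open>(A B; B C)\<close> is the sum of the Schur complement \<open>A - D\<close> in the upper left corner and of
  the terms \<open>N\<^sub>l N\<^sub>l\<^sup>* \<otimes> (d\<^sub>l, 1)\<^sup>T (d\<^sub>l, 1)\<close>. Since the \<open>d\<^sub>l\<close> are real, only real \<open>s\<close> and
  \<open>t\<close> are required in the hypothesis on \<open>X\<close>, \<open>Y\<close> and \<open>Z\<close>.
\<close>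

lemma op_form_pair_pos_def:
  assumes I: "finite I" and C: "pos_def_on I C" and B: "hermitian_on I B"
    and block: "\<And>v u. sesq I A v v + sesq I B v u + sesq I B u v + sesq I C u u \<in> \<real>\<^sub>\<ge>\<^sub>0"
    and bd: "X \<in> bounded_operators" "Y \<in> bounded_operators" "Z \<in> bounded_operators"
    and pos: "\<And>(s::real) (t::real) x. of_real (s\<^sup>2) * cinner x (X x) +
      of_real (s * t) * cinner x (Y x) + of_real (t\<^sup>2) * cinner x (Z x) \<in> \<real>\<^sub>\<ge>\<^sub>0"
  shows "op_form I A X x + op_form I B Y x + op_form I C Z x \<in> \<real>\<^sub>\<ge>\<^sub>0"
proof -
  from simultaneous_diagonalisation[OF I C B] obtain N R and d :: "'a \<Rightarrow> real"
    where Cd: "\<forall>i\<in>I. \<forall>j\<in>I. C i j = diag_form I (\<lambda>_. 1) N i j"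
      and Bd: "\<forall>i\<in>I. \<forall>j\<in>I. B i j = diag_form I (\<lambda>l. of_real (d l)) N i j"
      and dual: "\<forall>l\<in>I. \<forall>m\<in>I. (\<Sum>i\<in>I. cnj (N l i) * R m i) = (if l = m then 1 else 0)"
    by blast
  define D where "D = diag_form I (\<lambda>l. of_real ((d l)\<^sup>2)) N"
  have G: "sesq I (\<lambda>i j. A i j - D i j) v v \<in> \<real>\<^sub>\<ge>\<^sub>0" for v
  proof -
    define a where "a l = (\<Sum>i\<in>I. cnj (N l i) * v i)" for l
    \<comment> \<open>This \<open>u\<close> minimises the block form for the given \<open>v\<close>; it is \<open>- C\<^bsup>-1\<^esup> B v\<close>.\<close>
    define u where "u i = (\<Sum>m\<in>I. - of_real (d m) * a m * R m i)" for i
    have u: "(\<Sum>i\<in>I. cnj (N l i) * u i) = - of_real (d l) * a l" if l: "l \<in> I" for l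
    proof -
      have "(\<Sum>i\<in>I. cnj (N l i) * u i) =
        (\<Sum>m\<in>I. - of_real (d m) * a m * (\<Sum>i\<in>I. cnj (N l i) * R m i))"
        unfolding u_def sum_distrib_left by (subst sum.swap) (simp add: mult_ac)
      also have "\<dots> = (\<Sum>m\<in>I. if m = l then - of_real (d m) * a m else 0)"
        using dual l by (intro sum.cong) auto
      finally show ?thesis using I l by simp
    qed
    have "sesq I B v u = sesq I (diag_form I (\<lambda>l. of_real (d l)) N) v u"
      "sesq I B u v = sesq I (diag_form I (\<lambda>l. of_real (d l)) N) u v"
      "sesq I C u u = sesq I (diag_form I (\<lambda>_. 1) N) u u"
      using Bd Cd by (auto intro!: sesq_cong)
    moreover have "sesq I (diag_form I (\<lambda>l. of_real (d l)) N) v u = - sesq I D v v"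
      "sesq I (diag_form I (\<lambda>l. of_real (d l)) N) u v = - sesq I D v v"
      "sesq I (diag_form I (\<lambda>_. 1) N) u u = sesq I D v v"
      unfolding sesq_diag_form D_def a_def[symmetric] sum_negf[symmetric]
      by (auto intro!: sum.cong simp: u power2_eq_square)
    ultimately show ?thesis using block[of v u] by (simp add: sesq_diff_mat)
  qed
  define y where "y l = (\<Sum>j\<in>I. cnj (N l j) *\<^sub>C x j)" for l
  have "op_form I A X x = op_form I (\<lambda>i j. (A i j - D i j) + D i j) X x" by simp
  also have "\<dots> = op_form I (\<lambda>i j. A i j - D i j) X x + op_form I D X x" by (rule op_form_add)
  finally have 1: "op_form I A X x = op_form I (\<lambda>i j. A i j - D i j) X x + op_form I D X x" .
  have 2: "op_form I B Y x = op_form I (diag_form I (\<lambda>l. of_real (d l)) N) Y x"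
    "op_form I C Z x = op_form I (diag_form I (\<lambda>_. 1) N) Z x"
    using Bd Cd by (auto intro!: op_form_cong)
  have "op_form I D X x + op_form I B Y x + op_form I C Z x =
    (\<Sum>l\<in>I. of_real ((d l)\<^sup>2) * cinner (y l) (X (y l)) + of_real (d l * 1) * cinner (y l) (Y (y l))
      + of_real (1\<^sup>2) * cinner (y l) (Z (y l)))"
    unfolding 2 D_def op_form_diag_form[OF bd(1)] op_form_diag_form[OF bd(2)]
      op_form_diag_form[OF bd(3)] y_def[symmetric] by (simp add: sum.distrib)
  also have "\<dots> \<in> \<real>\<^sub>\<ge>\<^sub>0" by (intro nonneg_Reals_sum pos)
  finally have 3: "op_form I D X x + op_form I B Y x + op_form I C Z x \<in> \<real>\<^sub>\<ge>\<^sub>0" .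
  have "cinner x (X x) \<in> \<real>\<^sub>\<ge>\<^sub>0" for x using pos[of 1 x 0] by simp
  from nonneg_Reals_add_I[OF op_form_psd[OF I G bd(1) this, of x] 3]
  show ?thesis unfolding 1 by (simp add: add.assoc)
qed

text \<open>
  For \<open>C\<close> only semidefinite, add \<open>e\<close> times the identity. The value changes by a nonnegative multiple of
  \<open>e\<close>, so its nonnegativity survives the limit \<open>e \<rightarrow> 0\<close>. That \<open>B\<close> is Hermitian is seen by taking
  \<open>u = v\<close> in the block form.
\<close>

lemma op_form_pair:
  assumes I: "finite I"
    and block: "\<And>v u. sesq I A v v + sesq I B v u + sesq I B u v + sesq I C u u \<in> \<real>\<^sub>\<ge>\<^sub>0"
    and bd: "X \<in> bounded_operators" "Y \<in> bounded_operators" "Z \<in> bounded_operators"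
    and pos: "\<And>(s::real) (t::real) x. of_real (s\<^sup>2) * cinner x (X x) +
      of_real (s * t) * cinner x (Y x) + of_real (t\<^sup>2) * cinner x (Z x) \<in> \<real>\<^sub>\<ge>\<^sub>0"
  shows "op_form I A X x + op_form I B Y x + op_form I C Z x \<in> \<real>\<^sub>\<ge>\<^sub>0"
proof -
  have zero: "sesq I M (\<lambda>_. 0) v = 0" "sesq I M v (\<lambda>_. 0) = 0" for M v
    by (simp_all add: sesq_def)
  have psdA: "sesq I A v v \<in> \<real>\<^sub>\<ge>\<^sub>0" and psdC: "sesq I C v v \<in> \<real>\<^sub>\<ge>\<^sub>0" for v
    using block[of v "\<lambda>_. 0"] block[of "\<lambda>_. 0" v] by (simp_all add: zero)
  have "Im (sesq I B v v) = 0" for v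
    using block[of v v] psdA[of v] psdC[of v] by (simp add: complex_nonneg_Reals_iff)
  then have B: "hermitian_on I B" by (rule real_form_imp_hermitian[OF I])
  define E where "E e i j = (if i = j then complex_of_real e else 0)" for e and i j :: 'a
  have E: "sesq I (E e) v v \<in> \<real>\<^sub>\<ge>\<^sub>0" if "e \<ge> 0" for e v
    unfolding E_def sesq_scalar[OF I] using that
    by (intro nonneg_Reals_mult_I[OF _ nonneg_Reals_sum] cnj_mult_self_nonneg) simp
  define q where "q = op_form I A X x + op_form I B Y x + op_form I C Z x"
  define r where "r = op_form I (E 1) Z x"
  have Z: "cinner x (Z x) \<in> \<real>\<^sub>\<ge>\<^sub>0" for x using pos[of 0 x 1] by simp
  have r: "r \<in> \<real>\<^sub>\<ge>\<^sub>0" unfolding r_def by (rule op_form_psd[OF I E bd(3) Z]) simp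
  have q: "q + of_real e * r \<in> \<real>\<^sub>\<ge>\<^sub>0" if e: "e > 0" for e
  proof -
    define C' where "C' i j = C i j + E e i j" for i j
    have C': "sesq I C' v u = sesq I C v u + sesq I (E e) v u" for v u
      unfolding C'_def[abs_def] by (rule sesq_add_mat)
    have "pos_def_on I C'"
      unfolding pos_def_on_def
    proof (intro conjI allI impI)
      have "sesq I C' v v \<in> \<real>\<^sub>\<ge>\<^sub>0" for v
        unfolding C' using e by (intro nonneg_Reals_add_I psdC E) simp
      then show "hermitian_on I C'"
        by (intro real_form_imp_hermitian[OF I]) (simp add: complex_nonneg_Reals_iff)
      fix v :: "'a \<Rightarrow> complex" assume "\<exists>i\<in>I. v i \<noteq> 0"
      then obtain s where s: "s \<in> I" "v s \<noteq> 0" by blast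
      have "0 < Re (sesq I (E e) v v)"
        unfolding E_def sesq_scalar[OF I] using Re_sum_cnj_self_pos[where v = v, OF I s] e by simp
      then show "0 < Re (sesq I C' v v)"
        using psdC[of v] unfolding C' by (simp add: complex_nonneg_Reals_iff)
    qed
    moreover have "sesq I A v v + sesq I B v u + sesq I B u v + sesq I C' u u \<in> \<real>\<^sub>\<ge>\<^sub>0" for v u
      using nonneg_Reals_add_I[OF block[of v u] E[of e u]] e by (simp add: C' add.assoc)
    ultimately have "op_form I A X x + op_form I B Y x + op_form I C' Z x \<in> \<real>\<^sub>\<ge>\<^sub>0"
      by (intro op_form_pair_pos_def[OF I _ B _ bd pos])
    moreover have "op_form I C' Z x = op_form I C Z x + op_form I (E e) Z x"
      unfolding C'_def[abs_def] by (rule op_form_add)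
    moreover have "op_form I (E e) Z x = of_real e * r"
      unfolding r_def op_form_def E_def sum_distrib_left by (intro sum.cong) auto
    ultimately show ?thesis unfolding q_def by (simp add: add.assoc)
  qed
  have "Im q = 0" using q[of 1] r by (simp add: complex_nonneg_Reals_iff)
  moreover have "0 \<le> Re q"
  proof (rule ccontr)
    assume neg: "\<not> ?thesis"
    \<comment> \<open>If the limit were negative, a perturbation this small could not make it nonnegative.\<close>
    define b where "b = Re r + 1"
    define e where "e = - Re q / (2 * b)"
    have b: "b > 0" using r unfolding b_def by (simp add: complex_nonneg_Reals_iff)
    have e: "e > 0" unfolding e_def using neg b by (intro divide_pos_pos) auto
    have "e * Re r \<le> e * b" using e unfolding b_def by simp
    also have "\<dots> = - Re q / 2" unfolding e_def using b by simp
    finally have "Re q + e * Re r < 0" using neg by simp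
    with q[OF e] show False by (simp add: complex_nonneg_Reals_iff)
  qed
  ultimately show ?thesis unfolding q_def[symmetric] by (simp add: complex_nonneg_Reals_iff)
qed

section \<open>Positive semidefinite block matrices\<close>

lemma mat_adjoint_carrier: "A \<in> carrier_mat n m \<Longrightarrow> mat_adjoint A \<in> carrier_mat m n"
  unfolding mat_adjoint_def by auto

lemma mat_adjoint_index:
  "A \<in> carrier_mat n m \<Longrightarrow> i < m \<Longrightarrow> j < n \<Longrightarrow> mat_adjoint A $$ (i, j) = cnj (A $$ (j, i))"
  unfolding mat_adjoint_def by (auto simp: mat_of_rows_def)

lemma cscalar_prod_mat:
  assumes "A \<in> carrier_mat n m" "x \<in> carrier_vec m" "y \<in> carrier_vec n"
  shows "(A *\<^sub>v x) \<bullet>c y = (\<Sum>a<n. \<Sum>b<m. A $$ (a, b) * cnj (y $ a) * x $ b)"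
  using assms
  by (auto simp: scalar_prod_def atLeast0LessThan sum_distrib_left sum_distrib_right mult_ac
      intro!: sum.cong)

lemma cscalar_prod_adjoint:
  assumes A: "(A :: complex mat) \<in> carrier_mat n m" and x: "x \<in> carrier_vec m" and y: "y \<in> carrier_vec n"
  shows "(A *\<^sub>v x) \<bullet>c y = x \<bullet>c (mat_adjoint A *\<^sub>v y)"
proof -
  have "x \<bullet>c (mat_adjoint A *\<^sub>v y) = (\<Sum>b<m. x $ b * cnj (\<Sum>a<n. mat_adjoint A $$ (b, a) * y $ a))"
    using mat_adjoint_carrier[OF A] x y by (auto simp: scalar_prod_def atLeast0LessThan intro!: sum.cong)
  also have "\<dots> = (\<Sum>b<m. \<Sum>a<n. A $$ (a, b) * cnj (y $ a) * x $ b)"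
    by (intro sum.cong refl)
       (simp add: sum_distrib_left mat_adjoint_index[OF A] mult_ac)
  also have "\<dots> = (A *\<^sub>v x) \<bullet>c y"
    unfolding cscalar_prod_mat[OF assms] by (rule sum.swap)
  finally show ?thesis ..
qed

lemma cscalar_prod_conjugation:
  assumes V: "(V :: complex mat) \<in> carrier_mat n n" and M: "M \<in> carrier_mat n n"
    and x: "x \<in> carrier_vec n" and y: "y \<in> carrier_vec n"
  shows "(mat_adjoint V * M * V *\<^sub>v x) \<bullet>c y = (M *\<^sub>v (V *\<^sub>v x)) \<bullet>c (V *\<^sub>v y)"
proof -
  note V' = mat_adjoint_carrier[OF V]
  have Vx: "V *\<^sub>v x \<in> carrier_vec n" and Vy: "V *\<^sub>v y \<in> carrier_vec n"
    using mult_mat_vec_carrier[OF V] x y by auto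
  have MVx: "M *\<^sub>v (V *\<^sub>v x) \<in> carrier_vec n" by (rule mult_mat_vec_carrier[OF M Vx])
  have "mat_adjoint V * M * V *\<^sub>v x = mat_adjoint V *\<^sub>v (M *\<^sub>v (V *\<^sub>v x))"
    using assoc_mult_mat_vec[OF mult_carrier_mat[OF V' M] V x] assoc_mult_mat_vec[OF V' M Vx] by simp
  then have "(mat_adjoint V * M * V *\<^sub>v x) \<bullet>c y =
      conjugate (y \<bullet>c (mat_adjoint V *\<^sub>v (M *\<^sub>v (V *\<^sub>v x))))"
    using mult_mat_vec_carrier[OF V' MVx] y
    by (metis conjugate_conjugate_sprod conjugate_vec_sprod_comm carrier_vec_conjugate conjugate_id comm_scalar_prod)
  also have "y \<bullet>c (mat_adjoint V *\<^sub>v (M *\<^sub>v (V *\<^sub>v x))) = (V *\<^sub>v y) \<bullet>c (M *\<^sub>v (V *\<^sub>v x))"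
    by (rule cscalar_prod_adjoint[OF V y MVx, symmetric])
  also have "conjugate \<dots> = (M *\<^sub>v (V *\<^sub>v x)) \<bullet>c (V *\<^sub>v y)"
    using Vy MVx
    by (metis conjugate_conjugate_sprod conjugate_vec_sprod_comm carrier_vec_conjugate conjugate_id comm_scalar_prod)
  finally show ?thesis .
qed

lemma mat_adjoint_adjoint:
  assumes A: "A \<in> carrier_mat n m"
  shows "mat_adjoint (mat_adjoint A) = (A :: complex mat)"
  using mat_adjoint_carrier[OF A] mat_adjoint_carrier[OF mat_adjoint_carrier[OF A]] A
  by (intro eq_matI) (auto simp: mat_adjoint_index[OF mat_adjoint_carrier[OF A]] mat_adjoint_index[OF A])

lemma psd_mat_conjugation:
  assumes U: "U \<in> carrier_mat n n" and R: "psd_mat n R"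
  shows "psd_mat n (U * R * mat_adjoint U)"
proof -
  note U' = mat_adjoint_carrier[OF U]
  have Rc: "R \<in> carrier_mat n n" using R by (simp add: psd_mat_def)
  have "(U * R * mat_adjoint U *\<^sub>v v) \<bullet>c v \<in> \<real>\<^sub>\<ge>\<^sub>0" if v: "v \<in> carrier_vec n" for v
    using cscalar_prod_conjugation[OF U' Rc v v] mult_mat_vec_carrier[OF U' v] R
    unfolding mat_adjoint_adjoint[OF U] psd_mat_def by simp
  then show ?thesis
    unfolding psd_mat_def using mult_carrier_mat[OF mult_carrier_mat[OF U Rc] U'] by blast
qed

text \<open>Division with remainder is the index bijection behind \<open>flatten_blocks\<close>.\<close>

lemma sum_div_mod:
  fixes f :: "nat \<Rightarrow> nat \<Rightarrow> 'a::comm_monoid_add"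
  shows "(\<Sum>p<k * n. f (p div n) (p mod n)) = (\<Sum>i<k. \<Sum>a<n. f i a)"
proof -
  have "(\<Sum>p<k * n. f (p div n) (p mod n)) =
    (\<Sum>i<k. \<Sum>p\<in>{i * n..<i * n + n}. f (p div n) (p mod n))"
    by (rule sum.nat_group[symmetric])
  also have "\<dots> = (\<Sum>i<k. \<Sum>a<n. f i a)"
  proof (rule sum.cong[OF refl])
    fix i
    show "(\<Sum>p\<in>{i * n..<i * n + n}. f (p div n) (p mod n)) = (\<Sum>a<n. f i a)"
    proof (rule sum.reindex_bij_witness[of _ "\<lambda>a. i * n + a" "\<lambda>p. p - i * n"])
      fix p assume p: "p \<in> {i * n..<i * n + n}"
      then obtain a where "p = i * n + a" "a < n" by (metis add_less_cancel_left atLeastLessThan_iff le_Suc_ex)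
      then show "f i (p - i * n) = f (p div n) (p mod n)" by simp
    qed auto
  qed
  finally show ?thesis .
qed

lemma flatten_blocks_form:
  assumes A: "\<And>i j. i < k \<Longrightarrow> j < k \<Longrightarrow> A i j \<in> carrier_mat n n"
    and w: "\<And>i. i < k \<Longrightarrow> w i \<in> carrier_vec n"
    and v: "v \<in> carrier_vec (k * n)" and vw: "\<And>p. p < k * n \<Longrightarrow> v $ p = w (p div n) $ (p mod n)"
  shows "(flatten_blocks n k A *\<^sub>v v) \<bullet>c v = (\<Sum>i<k. \<Sum>j<k. (A i j *\<^sub>v w j) \<bullet>c w i)"
proof -
  have F: "flatten_blocks n k A \<in> carrier_mat (k * n) (k * n)" by (simp add: flatten_blocks_def)
  have "(flatten_blocks n k A *\<^sub>v v) \<bullet>c v = (\<Sum>p<k * n. \<Sum>q<k * n.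
      A (p div n) (q div n) $$ (p mod n, q mod n) * cnj (w (p div n) $ (p mod n)) * w (q div n) $ (q mod n))"
    unfolding cscalar_prod_mat[OF F v v] by (intro sum.cong refl) (simp add: flatten_blocks_def vw)
  also have "\<dots> = (\<Sum>p<k * n. \<Sum>j<k. \<Sum>b<n.
      A (p div n) j $$ (p mod n, b) * cnj (w (p div n) $ (p mod n)) * w j $ b)"
    by (intro sum.cong refl sum_div_mod)
  also have "\<dots> = (\<Sum>i<k. \<Sum>a<n. \<Sum>j<k. \<Sum>b<n. A i j $$ (a, b) * cnj (w i $ a) * w j $ b)"
    by (rule sum_div_mod)
  also have "\<dots> = (\<Sum>i<k. \<Sum>j<k. \<Sum>a<n. \<Sum>b<n. A i j $$ (a, b) * cnj (w i $ a) * w j $ b)"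
    by (intro sum.cong refl sum.swap)
  also have "\<dots> = (\<Sum>i<k. \<Sum>j<k. (A i j *\<^sub>v w j) \<bullet>c w i)"
    by (intro sum.cong refl) (simp add: cscalar_prod_mat[OF A w w])
  finally show ?thesis .
qed

text \<open>
  Positivity of the flattened matrix in terms of its blocks, where a vector of length \<open>k n\<close> is a family of
  \<open>k\<close> vectors of length \<open>n\<close>. In this form the blocks can be conjugated one by one.
\<close>

lemma psd_flatten_blocks_iff:
  assumes A: "\<And>i j. i < k \<Longrightarrow> j < k \<Longrightarrow> A i j \<in> carrier_mat n n"
  shows "psd_mat (k * n) (flatten_blocks n k A) \<longleftrightarrow>
    (\<forall>w. (\<forall>i. w i \<in> carrier_vec n) \<longrightarrow> (\<Sum>i<k. \<Sum>j<k. (A i j *\<^sub>v w j) \<bullet>c w i) \<in> \<real>\<^sub>\<ge>\<^sub>0)"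
proof (intro iffI allI impI)
  fix w :: "nat \<Rightarrow> complex vec"
  assume psd: "psd_mat (k * n) (flatten_blocks n k A)" and w: "\<forall>i. w i \<in> carrier_vec n"
  let ?v = "vec (k * n) (\<lambda>p. w (p div n) $ (p mod n))"
  have "(flatten_blocks n k A *\<^sub>v ?v) \<bullet>c ?v = (\<Sum>i<k. \<Sum>j<k. (A i j *\<^sub>v w j) \<bullet>c w i)"
    using w by (intro flatten_blocks_form[OF A]) auto
  moreover have "(flatten_blocks n k A *\<^sub>v ?v) \<bullet>c ?v \<in> \<real>\<^sub>\<ge>\<^sub>0"
    using psd unfolding psd_mat_def by (blast intro: vec_carrier)
  ultimately show "(\<Sum>i<k. \<Sum>j<k. (A i j *\<^sub>v w j) \<bullet>c w i) \<in> \<real>\<^sub>\<ge>\<^sub>0" by simp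
next
  assume form: "\<forall>w. (\<forall>i. w i \<in> carrier_vec n) \<longrightarrow> (\<Sum>i<k. \<Sum>j<k. (A i j *\<^sub>v w j) \<bullet>c w i) \<in> \<real>\<^sub>\<ge>\<^sub>0"
  show "psd_mat (k * n) (flatten_blocks n k A)"
    unfolding psd_mat_def
  proof (intro conjI ballI)
    show "flatten_blocks n k A \<in> carrier_mat (k * n) (k * n)" by (simp add: flatten_blocks_def)
    fix v :: "complex vec" assume v: "v \<in> carrier_vec (k * n)"
    define w where "w i = vec n (\<lambda>a. v $ (i * n + a))" for i
    have w: "w i \<in> carrier_vec n" for i by (simp add: w_def)
    have "v $ p = w (p div n) $ (p mod n)" if "p < k * n" for p
    proof -
      have "n > 0" using that by (cases n) auto
      then show ?thesis by (simp add: w_def)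
    qed
    from flatten_blocks_form[OF A w v this]
    show "(flatten_blocks n k A *\<^sub>v v) \<bullet>c v \<in> \<real>\<^sub>\<ge>\<^sub>0" using form w by simp
  qed
qed

lemma psd_flatten_blocks_form:
  assumes "psd_mat (k * n) (flatten_blocks n k A)"
    and "\<And>i j. i < k \<Longrightarrow> j < k \<Longrightarrow> A i j \<in> carrier_mat n n"
    and "\<And>i. w i \<in> carrier_vec n"
  shows "(\<Sum>i<k. \<Sum>j<k. (A i j *\<^sub>v w j) \<bullet>c w i) \<in> \<real>\<^sub>\<ge>\<^sub>0"
  using psd_flatten_blocks_iff[of k A n] assms by blast

lemma psd_flatten_blocks_conjugation:
  assumes U: "U \<in> carrier_mat n n" and psd: "psd_mat (k * n) (flatten_blocks n k A)"
    and A: "\<And>i j. i < k \<Longrightarrow> j < k \<Longrightarrow> A i j \<in> carrier_mat n n"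
  shows "psd_mat (k * n) (flatten_blocks n k (\<lambda>i j. mat_adjoint U * A i j * U))"
proof -
  have c: "mat_adjoint U * A i j * U \<in> carrier_mat n n" if "i < k" "j < k" for i j
    by (rule mult_carrier_mat[OF mult_carrier_mat[OF mat_adjoint_carrier[OF U] A[OF that]] U])
  have "(\<Sum>i<k. \<Sum>j<k. (mat_adjoint U * A i j * U *\<^sub>v w j) \<bullet>c w i) \<in> \<real>\<^sub>\<ge>\<^sub>0"
    if w: "\<forall>i. w i \<in> carrier_vec n" for w
  proof -
    have "(\<Sum>i<k. \<Sum>j<k. (mat_adjoint U * A i j * U *\<^sub>v w j) \<bullet>c w i) =
        (\<Sum>i<k. \<Sum>j<k. (A i j *\<^sub>v (U *\<^sub>v w j)) \<bullet>c (U *\<^sub>v w i))"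
      using w by (intro sum.cong refl cscalar_prod_conjugation[OF U A]) auto
    also have "\<dots> \<in> \<real>\<^sub>\<ge>\<^sub>0"
      using A w mult_mat_vec_carrier[OF U] by (intro psd_flatten_blocks_form[OF psd]) auto
    finally show ?thesis .
  qed
  with c show ?thesis by (subst psd_flatten_blocks_iff) auto
qed

lemma psd_mat_rank_one:
  "psd_mat n (mat n n (\<lambda>(i, j). complex_of_real (x i) * of_real (x j)))"
  unfolding psd_mat_def
proof (intro conjI ballI)
  fix v :: "complex vec" assume v: "v \<in> carrier_vec n"
  let ?s = "\<Sum>j<n. of_real (x j) * v $ j"
  have "(mat n n (\<lambda>(i, j). complex_of_real (x i) * of_real (x j)) *\<^sub>v v) \<bullet>c v =
    (\<Sum>a<n. \<Sum>b<n. (of_real (x a) * cnj (v $ a)) * (of_real (x b) * v $ b))"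
    using v by (subst cscalar_prod_mat[of _ n n]) (auto intro!: sum.cong)
  also have "\<dots> = cnj ?s * ?s" by (simp add: sum_product)
  also have "\<dots> \<in> \<real>\<^sub>\<ge>\<^sub>0" by (rule cnj_mult_self_nonneg)
  finally show "(mat n n (\<lambda>(i, j). complex_of_real (x i) * of_real (x j)) *\<^sub>v v) \<bullet>c v \<in> \<real>\<^sub>\<ge>\<^sub>0" .
qed simp

lemma unitary_conjugation_cancel:
  assumes U: "unitary_mat n U" and A: "A \<in> carrier_mat n n"
  shows "U * (mat_adjoint U * A * U) * mat_adjoint U = A"
proof -
  have Uc: "U \<in> carrier_mat n n" and inv: "U * mat_adjoint U = 1\<^sub>m n"
    using U by (simp_all add: unitary_mat_def)
  note U' = mat_adjoint_carrier[OF Uc]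
  note mc = mult_carrier_mat[of _ n n]
  have "U * (mat_adjoint U * A * U) = U * mat_adjoint U * A * U"
    using Uc U' A by (simp add: assoc_mult_mat[of _ n n _ n _ n] mc)
  then have "U * (mat_adjoint U * A * U) * mat_adjoint U = A * (U * mat_adjoint U)"
    using Uc U' A by (simp add: inv assoc_mult_mat[of _ n n _ n _ n])
  then show ?thesis using A by (simp add: inv)
qed

text \<open>
  The same condition for functions in place of vectors. Functions that vanish off one or two indices
  then compress the blocks to chosen entries.
\<close>

lemma psd_flatten_blocks_sesq:
  assumes psd: "psd_mat (k * n) (flatten_blocks n k A)"
    and A: "\<And>i j. i < k \<Longrightarrow> j < k \<Longrightarrow> A i j \<in> carrier_mat n n"
  shows "(\<Sum>i<k. \<Sum>j<k. sesq {..<n} (\<lambda>a b. A i j $$ (a, b)) (w i) (w j)) \<in> \<real>\<^sub>\<ge>\<^sub>0"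
proof -
  have "(\<Sum>i<k. \<Sum>j<k. (A i j *\<^sub>v vec n (w j)) \<bullet>c vec n (w i)) \<in> \<real>\<^sub>\<ge>\<^sub>0"
    by (rule psd_flatten_blocks_form[OF psd A]) simp_all
  also have "(\<Sum>i<k. \<Sum>j<k. (A i j *\<^sub>v vec n (w j)) \<bullet>c vec n (w i)) =
      (\<Sum>i<k. \<Sum>j<k. sesq {..<n} (\<lambda>a b. A i j $$ (a, b)) (w i) (w j))"
  proof (intro sum.cong refl)
    fix i j assume "i \<in> {..<k}" "j \<in> {..<k}"
    then have Ac: "A i j \<in> carrier_mat n n" using A by simp
    show "(A i j *\<^sub>v vec n (w j)) \<bullet>c vec n (w i) = sesq {..<n} (\<lambda>a b. A i j $$ (a, b)) (w i) (w j)"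
      by (subst cscalar_prod_mat[OF Ac]) (simp_all add: sesq_def)
  qed
  finally show ?thesis .
qed

section \<open>Spans of matrices\<close>

lemma module_complex_mat: "module class_ring (module_mat TYPE(complex) n n)"
  using matrix_vs[where 'a = complex] unfolding vectorspace_def by blast

lemma mat_span_superset: "B \<subseteq> carrier_mat n n \<Longrightarrow> B \<subseteq> mat_span n B"
  unfolding mat_span_def
  by (rule LinearCombinations.module.in_own_span[OF module_complex_mat]) (simp add: module_mat_simps)

lemma submodule_matI:
  assumes "W \<subseteq> carrier_mat n n" "0\<^sub>m n n \<in> W"
    and "\<And>M M'. M \<in> W \<Longrightarrow> M' \<in> W \<Longrightarrow> M + M' \<in> W" "\<And>c M. M \<in> W \<Longrightarrow> c \<cdot>\<^sub>m M \<in> W"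
  shows "submodule class_ring W (module_mat TYPE(complex) n n)"
  using assms by (intro submodule.intro module_complex_mat) (auto simp: module_mat_simps)

lemma submodule_matD:
  assumes "submodule class_ring W (module_mat TYPE(complex) n n)"
  shows "W \<subseteq> carrier_mat n n" "0\<^sub>m n n \<in> W"
    "\<And>M M'. M \<in> W \<Longrightarrow> M' \<in> W \<Longrightarrow> M + M' \<in> W" "\<And>c M. M \<in> W \<Longrightarrow> c \<cdot>\<^sub>m M \<in> W"
  using assms unfolding submodule_def by (auto simp: module_mat_simps class_ring_simps)

lemma submodule_mat_span:
  "B \<subseteq> carrier_mat n n \<Longrightarrow> submodule class_ring (mat_span n B) (module_mat TYPE(complex) n n)"
  unfolding mat_span_def
  by (rule LinearCombinations.module.span_is_submodule[OF module_complex_mat]) (simp add: module_mat_simps)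

text \<open>
  The hypotheses for sums and multiples may use membership in the span, as is required when the property
  concerns a map that is linear on the span only.
\<close>

lemma mat_span_induct:
  assumes M: "M \<in> mat_span n B" and B: "B \<subseteq> carrier_mat n n"
    and base: "\<And>M. M \<in> B \<Longrightarrow> P M" and zero: "P (0\<^sub>m n n)"
    and add: "\<And>M M'. M \<in> mat_span n B \<Longrightarrow> M' \<in> mat_span n B \<Longrightarrow> P M \<Longrightarrow> P M' \<Longrightarrow> P (M + M')"
    and smult: "\<And>c M. M \<in> mat_span n B \<Longrightarrow> P M \<Longrightarrow> P (c \<cdot>\<^sub>m M)"
  shows "P M"
proof -
  note D = submodule_matD[OF submodule_mat_span[OF B]]
  have "submodule class_ring {M \<in> mat_span n B. P M} (module_mat TYPE(complex) n n)"
    using D zero add smult by (intro submodule_matI) auto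
  then have "mat_span n B \<subseteq> {M \<in> mat_span n B. P M}"
    unfolding mat_span_def
    by (intro LinearCombinations.module.span_is_subset[OF module_complex_mat])
       (use base mat_span_superset[OF B] in \<open>auto simp: mat_span_def\<close>)
  with M show ?thesis by blast
qed

lemma operator_systemD:
  assumes "operator_system n S"
  shows "S \<subseteq> carrier_mat n n" "\<And>M M'. M \<in> S \<Longrightarrow> M' \<in> S \<Longrightarrow> M + M' \<in> S"
    "\<And>c M. M \<in> S \<Longrightarrow> c \<cdot>\<^sub>m M \<in> S" "1\<^sub>m n \<in> S"
proof -
  have "submodule class_ring S (module_mat TYPE(complex) n n)"
    using assms unfolding operator_system_def subspace_def by blast
  note D = submodule_matD[OF this]
  from D show "S \<subseteq> carrier_mat n n" "\<And>M M'. M \<in> S \<Longrightarrow> M' \<in> S \<Longrightarrow> M + M' \<in> S"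
    "\<And>c M. M \<in> S \<Longrightarrow> c \<cdot>\<^sub>m M \<in> S" by blast+
  show "1\<^sub>m n \<in> S" using assms unfolding operator_system_def by blast
qed

section \<open>Diagonal matrices with symmetric off-diagonal pairs\<close>

text \<open>
  Entries of matrices are indexed from \<open>0\<close> while matrix units are numbered from \<open>1\<close>; hence the
  shifts by one, which let \<open>p\<close> and \<open>q\<close> be indices from \<open>0\<close>.
\<close>

abbreviation diag_unit :: "nat \<Rightarrow> nat \<Rightarrow> complex mat" where
  "diag_unit n p \<equiv> matrix_unit n (Suc p) (Suc p)"

abbreviation pair_unit :: "nat \<Rightarrow> nat \<Rightarrow> complex mat" where
  "pair_unit n q \<equiv> matrix_unit n (Suc q) (Suc (Suc q)) + matrix_unit n (Suc (Suc q)) (Suc q)"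

lemma matrix_unit_carrier [simp]: "matrix_unit n i j \<in> carrier_mat n n"
  by (simp add: matrix_unit_def)

lemma diag_unit_index:
  "a < n \<Longrightarrow> b < n \<Longrightarrow> diag_unit n p $$ (a, b) = (if a = p \<and> b = p then 1 else 0)"
  by (simp add: matrix_unit_def)

lemma pair_unit_index:
  "a < n \<Longrightarrow> b < n \<Longrightarrow>
   pair_unit n q $$ (a, b) = (if a = q \<and> b = Suc q \<or> a = Suc q \<and> b = q then 1 else 0)"
  by (simp add: matrix_unit_def)

lemma psd_diag_unit: "p < n \<Longrightarrow> psd_mat n (diag_unit n p)"
proof -
  have "diag_unit n p = mat n n (\<lambda>(i, j). complex_of_real (if i = p then 1 else 0) * of_real (if j = p then 1 else 0))"
    by (rule eq_matI) (auto simp: matrix_unit_def)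
  then show ?thesis using psd_mat_rank_one[of n "\<lambda>i. if i = p then 1 else 0"] by simp
qed

lemma psd_pair_combination:
  fixes s t :: real
  assumes "Suc q < n"
  shows "psd_mat n (of_real (s\<^sup>2) \<cdot>\<^sub>m diag_unit n q + of_real (s * t) \<cdot>\<^sub>m pair_unit n q +
    of_real (t\<^sup>2) \<cdot>\<^sub>m diag_unit n (Suc q))"
proof -
  let ?x = "\<lambda>i. if i = q then s else if i = Suc q then t else 0"
  have "of_real (s\<^sup>2) \<cdot>\<^sub>m diag_unit n q + of_real (s * t) \<cdot>\<^sub>m pair_unit n q +
      of_real (t\<^sup>2) \<cdot>\<^sub>m diag_unit n (Suc q) = mat n n (\<lambda>(i, j). complex_of_real (?x i) * of_real (?x j))"
    by (rule eq_matI) (auto simp: matrix_unit_def power2_eq_square)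
  then show ?thesis using psd_mat_rank_one[of n ?x] by simp
qed

text \<open>
  The shape of a spanning set as in the theorem whose span contains the identity. Overlapping pairs are
  excluded only where terms are grouped by pairs.
\<close>

locale pair_pattern =
  fixes n :: nat and B :: "complex mat set" and J :: "nat set"
  assumes J: "\<And>q. q \<in> J \<Longrightarrow> Suc q < n"
    and B: "B = diag_unit n ` {..<n} \<union> pair_unit n ` J"
begin

lemma finite_J: "finite J"
  using J by (intro finite_subset[of J "{..<n}"]) (auto intro: Suc_lessD)

lemma B_carrier: "B \<subseteq> carrier_mat n n"
  unfolding B by auto

lemma diag_in_span: "p < n \<Longrightarrow> diag_unit n p \<in> mat_span n B"
  using mat_span_superset[OF B_carrier] B by blast

lemma pair_in_span: "q \<in> J \<Longrightarrow> pair_unit n q \<in> mat_span n B"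
  using mat_span_superset[OF B_carrier] B by blast

lemma span_symmetric:
  assumes M: "M \<in> mat_span n B"
  shows "\<forall>a<n. \<forall>b<n. M $$ (a, b) = M $$ (b, a)"
proof (rule mat_span_induct[OF M B_carrier, of "\<lambda>M. \<forall>a<n. \<forall>b<n. M $$ (a, b) = M $$ (b, a)"])
  fix M assume "M \<in> B"
  then show "\<forall>a<n. \<forall>b<n. M $$ (a, b) = M $$ (b, a)"
    unfolding B by (auto simp: diag_unit_index pair_unit_index simp del: index_add_mat)
next
  note D = submodule_matD(1)[OF submodule_mat_span[OF B_carrier]]
  fix M M' c assume M: "M \<in> mat_span n B" "\<forall>a<n. \<forall>b<n. M $$ (a, b) = M $$ (b, a)"
  from M(1) D have Mc: "M \<in> carrier_mat n n" by blast
  then show "\<forall>a<n. \<forall>b<n. (c \<cdot>\<^sub>m M) $$ (a, b) = (c \<cdot>\<^sub>m M) $$ (b, a)" using M(2) by simp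
  assume M': "M' \<in> mat_span n B" "\<forall>a<n. \<forall>b<n. M' $$ (a, b) = M' $$ (b, a)"
  from M'(1) D have "M' \<in> carrier_mat n n" by blast
  then show "\<forall>a<n. \<forall>b<n. (M + M') $$ (a, b) = (M + M') $$ (b, a)" using M(2) M'(2) Mc by simp
qed simp

text \<open>
  Both sides are linear in \<open>M\<close> and agree on \<open>B\<close>. Applied to the functionals
  \<open>M \<mapsto> \<langle>y, \<Psi>(M) z\<rangle>\<close>, this expands the values of an operator map in those at \<open>B\<close>.
\<close>

lemma span_functional_expansion:
  fixes g :: "complex mat \<Rightarrow> complex"
  assumes M: "M \<in> mat_span n B"
    and add: "\<And>M M'. M \<in> mat_span n B \<Longrightarrow> M' \<in> mat_span n B \<Longrightarrow> g (M + M') = g M + g M'"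
    and smult: "\<And>c M. M \<in> mat_span n B \<Longrightarrow> g (c \<cdot>\<^sub>m M) = c * g M"
  shows "g M = (\<Sum>p<n. M $$ (p, p) * g (diag_unit n p)) + (\<Sum>q\<in>J. M $$ (q, Suc q) * g (pair_unit n q))"
proof (rule mat_span_induct[OF M B_carrier, of "\<lambda>M. g M = (\<Sum>p<n. M $$ (p, p) * g (diag_unit n p)) +
    (\<Sum>q\<in>J. M $$ (q, Suc q) * g (pair_unit n q))"])
  fix M assume "M \<in> B"
  then consider p where "p < n" "M = diag_unit n p" | q where "q \<in> J" "M = pair_unit n q"
    unfolding B by blast
  then show "g M = (\<Sum>p<n. M $$ (p, p) * g (diag_unit n p)) + (\<Sum>q\<in>J. M $$ (q, Suc q) * g (pair_unit n q))"
  proof cases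
    case (1 p)
    have "(\<Sum>p'<n. M $$ (p', p') * g (diag_unit n p')) = (\<Sum>p'<n. if p' = p then g M else 0)"
      using 1 by (intro sum.cong) (auto simp: diag_unit_index)
    moreover have "(\<Sum>q\<in>J. M $$ (q, Suc q) * g (pair_unit n q)) = 0"
      using 1 J by (intro sum.neutral) (auto simp: diag_unit_index Suc_lessD)
    ultimately show ?thesis using 1 by simp
  next
    case (2 q)
    have "(\<Sum>p'<n. M $$ (p', p') * g (diag_unit n p')) = 0"
      using 2 by (intro sum.neutral) (auto simp: pair_unit_index simp del: index_add_mat)
    moreover have "(\<Sum>q'\<in>J. M $$ (q', Suc q') * g (pair_unit n q')) = (\<Sum>q'\<in>J. if q' = q then g M else 0)"
      using 2 J by (intro sum.cong) (auto simp: pair_unit_index Suc_lessD simp del: index_add_mat)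
    ultimately show ?thesis using 2 finite_J by simp
  qed
next
  note D = submodule_matD[OF submodule_mat_span[OF B_carrier]]
  have "g (0 \<cdot>\<^sub>m 0\<^sub>m n n) = 0" by (subst smult) (use D(2) in auto)
  then have "g (0\<^sub>m n n) = 0" by simp
  moreover have "(\<Sum>q\<in>J. 0\<^sub>m n n $$ (q, Suc q) * g (pair_unit n q)) = 0"
    using J by (intro sum.neutral) (auto simp: Suc_lessD)
  ultimately show "g (0\<^sub>m n n) = (\<Sum>p<n. 0\<^sub>m n n $$ (p, p) * g (diag_unit n p)) +
    (\<Sum>q\<in>J. 0\<^sub>m n n $$ (q, Suc q) * g (pair_unit n q))" by simp
next
  note D = submodule_matD(1)[OF submodule_mat_span[OF B_carrier]]
  let ?e = "\<lambda>M. (\<Sum>p<n. M $$ (p, p) * g (diag_unit n p)) + (\<Sum>q\<in>J. M $$ (q, Suc q) * g (pair_unit n q))"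
  fix M M' c assume M: "M \<in> mat_span n B" "g M = ?e M"
  from M(1) D have Mc: "M \<in> carrier_mat n n" by blast
  have "(\<Sum>q\<in>J. (c \<cdot>\<^sub>m M) $$ (q, Suc q) * g (pair_unit n q)) =
      c * (\<Sum>q\<in>J. M $$ (q, Suc q) * g (pair_unit n q))"
    unfolding sum_distrib_left using Mc J by (intro sum.cong) (auto simp: Suc_lessD)
  moreover have "(\<Sum>p<n. (c \<cdot>\<^sub>m M) $$ (p, p) * g (diag_unit n p)) =
      c * (\<Sum>p<n. M $$ (p, p) * g (diag_unit n p))"
    unfolding sum_distrib_left using Mc by (intro sum.cong) auto
  ultimately show "g (c \<cdot>\<^sub>m M) = ?e (c \<cdot>\<^sub>m M)"
    using M by (simp add: smult distrib_left)
  assume M': "M' \<in> mat_span n B" "g M' = ?e M'"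
  from M'(1) D have M'c: "M' \<in> carrier_mat n n" by blast
  have "(\<Sum>q\<in>J. (M + M') $$ (q, Suc q) * g (pair_unit n q)) =
      (\<Sum>q\<in>J. M $$ (q, Suc q) * g (pair_unit n q)) + (\<Sum>q\<in>J. M' $$ (q, Suc q) * g (pair_unit n q))"
    unfolding sum.distrib[symmetric] using Mc M'c J
    by (intro sum.cong) (auto simp: Suc_lessD distrib_right)
  moreover have "(\<Sum>p<n. (M + M') $$ (p, p) * g (diag_unit n p)) =
      (\<Sum>p<n. M $$ (p, p) * g (diag_unit n p)) + (\<Sum>p<n. M' $$ (p, p) * g (diag_unit n p))"
    unfolding sum.distrib[symmetric] using Mc M'c by (intro sum.cong) (auto simp: distrib_right)
  ultimately show "g (M + M') = ?e (M + M')"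
    using M M' by (simp add: add)
qed

end

text \<open>
  As \<open>J\<close> has only even elements, the pairs \<open>{q, q + 1}\<close> are disjoint, and each pair term can
  be combined with the two diagonal terms that it meets.
\<close>

lemma sum_pair_grouping:
  fixes f :: "nat \<Rightarrow> complex"
  assumes J: "\<And>q. q \<in> J \<Longrightarrow> Suc q < n" and even: "\<And>q. q \<in> J \<Longrightarrow> even q"
  shows "sum f {..<n} + sum h J =
    sum f ({..<n} - (J \<union> Suc ` J)) + (\<Sum>q\<in>J. f q + h q + f (Suc q))"
proof -
  have fin: "finite J" using J by (intro finite_subset[of J "{..<n}"]) (auto intro: Suc_lessD)
  have disj: "J \<inter> Suc ` J = {}"
  proof (rule equals0I)
    fix r assume "r \<in> J \<inter> Suc ` J"
    then obtain q where "q \<in> J" "Suc q \<in> J" by auto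
    with even[of q] even[of "Suc q"] show False by simp
  qed
  have "J \<union> Suc ` J \<subseteq> {..<n}" using J by (auto intro: Suc_lessD)
  then have "sum f {..<n} = sum f ({..<n} - (J \<union> Suc ` J)) + sum f (J \<union> Suc ` J)"
    by (intro sum.subset_diff) auto
  also have "sum f (J \<union> Suc ` J) = sum f J + sum f (Suc ` J)"
    using fin disj by (intro sum.union_disjoint) auto
  also have "sum f (Suc ` J) = (\<Sum>q\<in>J. f (Suc q))" by (subst sum.reindex) auto
  finally show ?thesis by (simp add: sum.distrib)
qed

context pair_pattern
begin

lemma diag_entries_psd:
  assumes psd: "psd_mat (k * n) (flatten_blocks n k A)"
    and A: "\<And>i j. i < k \<Longrightarrow> j < k \<Longrightarrow> A i j \<in> mat_span n B" and p: "p < n"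
  shows "sesq {..<k} (\<lambda>i j. A i j $$ (p, p)) v v \<in> \<real>\<^sub>\<ge>\<^sub>0"
proof -
  have Ac: "A i j \<in> carrier_mat n n" if "i < k" "j < k" for i j
    using A[OF that] submodule_matD(1)[OF submodule_mat_span[OF B_carrier]] by blast
  have "(\<Sum>i<k. \<Sum>j<k. sesq {..<n} (\<lambda>a b. A i j $$ (a, b))
      (\<lambda>a. if a = p then v i else 0) (\<lambda>a. if a = p then v j else 0)) \<in> \<real>\<^sub>\<ge>\<^sub>0"
    by (rule psd_flatten_blocks_sesq[OF psd Ac])
  then show ?thesis using p by (simp add: sesq_delta_scaled) (simp add: sesq_def)
qed

text \<open>
  The compression to the indices \<open>q\<close> and \<open>q + 1\<close>. Symmetry of the span puts the same matrix in both
  off-diagonal corners.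
\<close>

lemma pair_entries_psd:
  assumes psd: "psd_mat (k * n) (flatten_blocks n k A)"
    and A: "\<And>i j. i < k \<Longrightarrow> j < k \<Longrightarrow> A i j \<in> mat_span n B" and q: "q \<in> J"
  shows "sesq {..<k} (\<lambda>i j. A i j $$ (q, q)) v v + sesq {..<k} (\<lambda>i j. A i j $$ (q, Suc q)) v u +
    sesq {..<k} (\<lambda>i j. A i j $$ (q, Suc q)) u v +
    sesq {..<k} (\<lambda>i j. A i j $$ (Suc q, Suc q)) u u \<in> \<real>\<^sub>\<ge>\<^sub>0"
proof -
  have Ac: "A i j \<in> carrier_mat n n" if "i < k" "j < k" for i j
    using A[OF that] submodule_matD(1)[OF submodule_mat_span[OF B_carrier]] by blast
  have qn: "q \<in> {..<n}" "Suc q \<in> {..<n}" using J[OF q] by auto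
  note delta = sesq_delta_scaled[OF finite_lessThan]
  have "(\<Sum>i<k. \<Sum>j<k. sesq {..<n} (\<lambda>a b. A i j $$ (a, b))
      (\<lambda>a. (if a = q then v i else 0) + (if a = Suc q then u i else 0))
      (\<lambda>a. (if a = q then v j else 0) + (if a = Suc q then u j else 0))) \<in> \<real>\<^sub>\<ge>\<^sub>0"
    by (rule psd_flatten_blocks_sesq[OF psd Ac])
  then have "sesq {..<k} (\<lambda>i j. A i j $$ (q, q)) v v + sesq {..<k} (\<lambda>i j. A i j $$ (q, Suc q)) v u +
    sesq {..<k} (\<lambda>i j. A i j $$ (Suc q, q)) u v +
    sesq {..<k} (\<lambda>i j. A i j $$ (Suc q, Suc q)) u u \<in> \<real>\<^sub>\<ge>\<^sub>0"
    unfolding sesq_add_left sesq_add_right delta[OF qn(1) qn(1)] delta[OF qn(1) qn(2)]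
      delta[OF qn(2) qn(1)] delta[OF qn(2) qn(2)]
    by (simp add: sesq_def sum.distrib add_ac)
  moreover have "sesq {..<k} (\<lambda>i j. A i j $$ (Suc q, q)) u v = sesq {..<k} (\<lambda>i j. A i j $$ (q, Suc q)) u v"
    using span_symmetric[OF A] qn by (intro sesq_cong) auto
  ultimately show ?thesis by simp
qed

text \<open>
  The quadratic form of \<open>\<Psi>\<close> applied to the blocks is the sum of a term for each diagonal unit and
  one for each pair unit. A diagonal term off the pairs is nonnegative by itself. Each pair term is taken
  together with its two diagonal terms, and \<open>op_form_pair\<close> applies.
\<close>

lemma positive_map_completely_positive:
  fixes \<Psi> :: "complex mat \<Rightarrow> 'k::complex_hilbert_space \<Rightarrow> 'k"
  assumes even: "\<And>q. q \<in> J \<Longrightarrow> even q"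
    and lin: "linear_into_operators (mat_span n B) \<Psi>"
    and pos: "positive_map n (mat_span n B) \<Psi>"
  shows "completely_positive_map n (mat_span n B) \<Psi>"
  unfolding completely_positive_map_def positive_block_op_def
proof (intro allI impI conjI)
  note D = submodule_matD[OF submodule_mat_span[OF B_carrier]]
  have bd: "\<Psi> M \<in> bounded_operators" if "M \<in> mat_span n B" for M
    using lin that unfolding linear_into_operators_def by blast
  have add: "\<Psi> (M + M') z = \<Psi> M z + \<Psi> M' z" if "M \<in> mat_span n B" "M' \<in> mat_span n B" for M M' z
    using lin that unfolding linear_into_operators_def by metis
  have smult: "\<Psi> (c \<cdot>\<^sub>m M) z = c *\<^sub>C \<Psi> M z" if "M \<in> mat_span n B" for c M z
    using lin that unfolding linear_into_operators_def by metis
  have psd: "cinner z (\<Psi> M z) \<in> \<real>\<^sub>\<ge>\<^sub>0" if "M \<in> mat_span n B" "psd_mat n M" for M z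
    using pos that unfolding positive_map_def positive_op_def by blast
  fix k :: nat and A
  assume A: "\<forall>i<k. \<forall>j<k. A i j \<in> mat_span n B" and psdA: "psd_mat (k * n) (flatten_blocks n k A)"
  show "\<Psi> (A i j) \<in> bounded_operators" if "i < k" "j < k" for i j
    using A that by (intro bd) blast
  fix x :: "nat \<Rightarrow> 'k"
  define d where "d p = op_form {..<k} (\<lambda>i j. A i j $$ (p, p)) (\<Psi> (diag_unit n p)) x" for p
  define b where "b q = op_form {..<k} (\<lambda>i j. A i j $$ (q, Suc q)) (\<Psi> (pair_unit n q)) x" for q
  have swap: "(\<Sum>i<k. \<Sum>j<k. sum (F i j) P) = (\<Sum>p\<in>P. \<Sum>i<k. \<Sum>j<k. F i j p)"
    for F :: "nat \<Rightarrow> nat \<Rightarrow> nat \<Rightarrow> complex" and P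
  proof -
    have "(\<Sum>i<k. \<Sum>j<k. sum (F i j) P) = (\<Sum>i<k. \<Sum>p\<in>P. \<Sum>j<k. F i j p)"
      by (intro sum.cong[OF refl] sum.swap)
    also have "\<dots> = (\<Sum>p\<in>P. \<Sum>i<k. \<Sum>j<k. F i j p)" by (rule sum.swap)
    finally show ?thesis .
  qed
  have "direct_sum_cinner k x (block_op_apply k (\<lambda>i j. \<Psi> (A i j)) x) =
    (\<Sum>i<k. \<Sum>j<k. cinner (x i) (\<Psi> (A i j) (x j)))"
    unfolding direct_sum_cinner_def block_op_apply_def by (simp add: cinner_sum_right)
  also have "\<dots> = (\<Sum>i<k. \<Sum>j<k.
      (\<Sum>p<n. A i j $$ (p, p) * cinner (x i) (\<Psi> (diag_unit n p) (x j))) +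
      (\<Sum>q\<in>J. A i j $$ (q, Suc q) * cinner (x i) (\<Psi> (pair_unit n q) (x j))))"
    using A by (intro sum.cong refl span_functional_expansion)
      (auto simp: add smult cinner_add_right cinner_scale_right)
  also have "\<dots> = (\<Sum>i<k. \<Sum>j<k. \<Sum>p<n. A i j $$ (p, p) * cinner (x i) (\<Psi> (diag_unit n p) (x j))) +
      (\<Sum>i<k. \<Sum>j<k. \<Sum>q\<in>J. A i j $$ (q, Suc q) * cinner (x i) (\<Psi> (pair_unit n q) (x j)))"
    by (simp add: sum.distrib)
  also have "(\<Sum>i<k. \<Sum>j<k. \<Sum>p<n. A i j $$ (p, p) * cinner (x i) (\<Psi> (diag_unit n p) (x j))) = sum d {..<n}"
    unfolding d_def op_form_def
    by (rule swap)
  also have "(\<Sum>i<k. \<Sum>j<k. \<Sum>q\<in>J. A i j $$ (q, Suc q) * cinner (x i) (\<Psi> (pair_unit n q) (x j))) = sum b J"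
    unfolding b_def op_form_def
    by (rule swap)
  also have "sum d {..<n} + sum b J =
      sum d ({..<n} - (J \<union> Suc ` J)) + (\<Sum>q\<in>J. d q + b q + d (Suc q))"
    by (rule sum_pair_grouping[OF J even])
  also have "\<dots> \<in> \<real>\<^sub>\<ge>\<^sub>0"
  proof (rule nonneg_Reals_add_I; rule nonneg_Reals_sum)
    fix p assume "p \<in> {..<n} - (J \<union> Suc ` J)"
    then have p: "p < n" by simp
    show "d p \<in> \<real>\<^sub>\<ge>\<^sub>0"
      unfolding d_def
    proof (rule op_form_psd)
      show "sesq {..<k} (\<lambda>i j. A i j $$ (p, p)) v v \<in> \<real>\<^sub>\<ge>\<^sub>0" for v
        using A by (intro diag_entries_psd[OF psdA _ p]) blast
    qed (auto intro!: bd psd diag_in_span psd_diag_unit p)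
  next
    fix q assume q: "q \<in> J"
    then have qn: "q < n" "Suc q < n" using J[OF q] by auto
    note E = diag_in_span[OF qn(1)] diag_in_span[OF qn(2)] pair_in_span[OF q]
    show "d q + b q + d (Suc q) \<in> \<real>\<^sub>\<ge>\<^sub>0"
      unfolding d_def b_def
    proof (rule op_form_pair)
      show "sesq {..<k} (\<lambda>i j. A i j $$ (q, q)) v v + sesq {..<k} (\<lambda>i j. A i j $$ (q, Suc q)) v u +
        sesq {..<k} (\<lambda>i j. A i j $$ (q, Suc q)) u v +
        sesq {..<k} (\<lambda>i j. A i j $$ (Suc q, Suc q)) u u \<in> \<real>\<^sub>\<ge>\<^sub>0" for v u
        using A by (intro pair_entries_psd[OF psdA _ q]) blast
      fix s t :: real and z :: 'k
      have "cinner z (\<Psi> (of_real (s\<^sup>2) \<cdot>\<^sub>m diag_unit n q + of_real (s * t) \<cdot>\<^sub>m pair_unit n q +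
          of_real (t\<^sup>2) \<cdot>\<^sub>m diag_unit n (Suc q)) z) \<in> \<real>\<^sub>\<ge>\<^sub>0"
        by (rule psd[OF _ psd_pair_combination[OF qn(2)]]) (intro D(3) D(4) E)
      then show "of_real (s\<^sup>2) * cinner z (\<Psi> (diag_unit n q) z) +
          of_real (s * t) * cinner z (\<Psi> (pair_unit n q) z) +
          of_real (t\<^sup>2) * cinner z (\<Psi> (diag_unit n (Suc q)) z) \<in> \<real>\<^sub>\<ge>\<^sub>0"
        by (simp only: add[OF D(3)[OF D(4)[OF E(1)] D(4)[OF E(3)]] D(4)[OF E(2)]]
            add[OF D(4)[OF E(1)] D(4)[OF E(3)]] smult[OF E(1)] smult[OF E(2)] smult[OF E(3)]
            cinner_add_right cinner_scale_right)
    qed (simp_all only: finite_lessThan bd[OF E(1)] bd[OF E(2)] bd[OF E(3)])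
  qed
  finally show "direct_sum_cinner k x (block_op_apply k (\<lambda>i j. \<Psi> (A i j)) x) \<in> \<real>\<^sub>\<ge>\<^sub>0" .
qed

end

section \<open>Maximality\<close>

lemma completely_positive_map_conjugation:
  assumes U: "U \<in> carrier_mat n n" and S: "S \<subseteq> carrier_mat n n"
    and conj: "\<And>A. A \<in> S \<Longrightarrow> mat_adjoint U * A * U \<in> T"
    and \<Phi>: "\<And>A. A \<in> S \<Longrightarrow> \<Phi> A = \<Psi> (mat_adjoint U * A * U)"
    and cp: "completely_positive_map n T \<Psi>"
  shows "completely_positive_map n S \<Phi>"
  unfolding completely_positive_map_def
proof (intro allI impI)
  fix k :: nat and A
  assume k: "1 \<le> k" and A: "\<forall>i<k. \<forall>j<k. A i j \<in> S" and psd: "psd_mat (k * n) (flatten_blocks n k A)"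
  have psd': "psd_mat (k * n) (flatten_blocks n k (\<lambda>i j. mat_adjoint U * A i j * U))"
    using A S by (intro psd_flatten_blocks_conjugation[OF U psd]) blast
  have pos: "positive_block_op k (\<lambda>i j. \<Psi> (mat_adjoint U * A i j * U))"
    by (rule cp[unfolded completely_positive_map_def, rule_format, OF k _ psd'])
      (use A in \<open>auto intro: conj\<close>)
  have eq: "\<Phi> (A i j) = \<Psi> (mat_adjoint U * A i j * U)" if "i < k" "j < k" for i j
    using A that by (intro \<Phi>) blast
  have "direct_sum_cinner k x (block_op_apply k (\<lambda>i j. \<Phi> (A i j)) x) =
      direct_sum_cinner k x (block_op_apply k (\<lambda>i j. \<Psi> (mat_adjoint U * A i j * U)) x)" for x
    unfolding direct_sum_cinner_def block_op_apply_def
    by (intro sum.cong refl arg_cong2[of _ _ _ _ cinner]) (simp add: eq)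
  with pos show "positive_block_op k (\<lambda>i j. \<Phi> (A i j))"
    unfolding positive_block_op_def by (simp add: eq)
qed

text \<open>
  If \<open>E\<^sub>p\<^sub>p\<close> were missing from \<open>B\<close>, then all members of \<open>B\<close>, and with them the identity, would have
  the entry \<open>0\<close> at \<open>(p, p)\<close>.
\<close>

lemma spanning_set_pair_pattern:
  assumes B: "B \<subseteq> {matrix_unit n j j | j. 1 \<le> j \<and> j \<le> n} \<union>
      {matrix_unit n (2 * j - 1) (2 * j) + matrix_unit n (2 * j) (2 * j - 1) | j.
         1 \<le> j \<and> real j \<le> real n / 2}"
    and one: "1\<^sub>m n \<in> mat_span n B"
  shows "\<exists>J. pair_pattern n B J \<and> (\<forall>q\<in>J. even q)"
proof -
  define J where "J = {q. even q \<and> Suc q < n \<and> pair_unit n q \<in> B}"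
  have sub: "B \<subseteq> diag_unit n ` {..<n} \<union> pair_unit n ` J"
  proof
    fix M assume M: "M \<in> B"
    with B consider j where "1 \<le> j" "j \<le> n" "M = matrix_unit n j j"
      | j where "1 \<le> j" "real j \<le> real n / 2"
          "M = matrix_unit n (2 * j - 1) (2 * j) + matrix_unit n (2 * j) (2 * j - 1)" by blast
    then show "M \<in> diag_unit n ` {..<n} \<union> pair_unit n ` J"
    proof cases
      case (1 j)
      then obtain p where "j = Suc p" by (cases j) auto
      with 1 show ?thesis by auto
    next
      case (2 j)
      then obtain i where j: "j = Suc i" by (cases j) auto
      from 2(2) have "2 * j \<le> n" by linarith
      moreover have "M = pair_unit n (2 * i)" using 2(3) j by simp
      ultimately have "2 * i \<in> J" using M j by (simp add: J_def)
      then show ?thesis using \<open>M = pair_unit n (2 * i)\<close> by blast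
    qed
  qed
  then have Bc: "B \<subseteq> carrier_mat n n" by auto
  have diag: "diag_unit n p \<in> B" if p: "p < n" for p
  proof (rule ccontr)
    assume no: "diag_unit n p \<notin> B"
    note D = submodule_matD(1)[OF submodule_mat_span[OF Bc]]
    have "1\<^sub>m n $$ (p, p) = (0 :: complex)"
    proof (rule mat_span_induct[OF one Bc, of "\<lambda>M. M $$ (p, p) = 0"])
      fix M assume M: "M \<in> B"
      with sub consider p' where "p' < n" "M = diag_unit n p'" | q where "q \<in> J" "M = pair_unit n q"
        by blast
      then show "M $$ (p, p) = 0"
      proof cases
        case (1 p')
        then have "p' \<noteq> p" using M no by auto
        then show ?thesis using 1 p by (simp add: diag_unit_index)
      next
        case 2
        then show ?thesis using p by (simp add: pair_unit_index del: index_add_mat)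
      qed
    next
      fix M M' assume M: "M \<in> mat_span n B" "M $$ (p, p) = 0"
      from M(1) D have Mc: "M \<in> carrier_mat n n" by blast
      then show "(c \<cdot>\<^sub>m M) $$ (p, p) = 0" for c using M(2) p by simp
      assume M': "M' \<in> mat_span n B" "M' $$ (p, p) = 0"
      from M'(1) D have "M' \<in> carrier_mat n n" by blast
      then show "(M + M') $$ (p, p) = 0" using M(2) M'(2) Mc p by simp
    qed (use p in simp)
    with p show False by simp
  qed
  have "pair_pattern n B J"
  proof
    show "Suc q < n" if "q \<in> J" for q using that by (simp add: J_def)
    show "B = diag_unit n ` {..<n} \<union> pair_unit n ` J" using sub diag by (auto simp: J_def)
  qed
  moreover have "\<forall>q\<in>J. even q" by (simp add: J_def)
  ultimately show ?thesis by blast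
qed

theorem theorem3p2:
  fixes n :: nat and S :: "complex mat set"
  assumes "operator_system n S"
    and "\<exists>U. unitary_mat n U \<and>
           (\<exists>B \<subseteq> {matrix_unit n j j | j. 1 \<le> j \<and> j \<le> n} \<union>
                  {matrix_unit n (2 * j - 1) (2 * j) + matrix_unit n (2 * j) (2 * j - 1) | j.
                     1 \<le> j \<and> real j \<le> real n / 2}.
              {mat_adjoint U * A * U | A. A \<in> S} = mat_span n B)"
  shows "maximal_operator_system TYPE('k::complex_hilbert_space) n S"
proof -
  from assms(2) obtain U B where U: "unitary_mat n U"
    and B: "B \<subseteq> {matrix_unit n j j | j. 1 \<le> j \<and> j \<le> n} \<union>
                  {matrix_unit n (2 * j - 1) (2 * j) + matrix_unit n (2 * j) (2 * j - 1) | j.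
                     1 \<le> j \<and> real j \<le> real n / 2}"
    and span: "{mat_adjoint U * A * U | A. A \<in> S} = mat_span n B" by blast
  note S = operator_systemD[OF assms(1)]
  have Uc: "U \<in> carrier_mat n n" and UU: "mat_adjoint U * U = 1\<^sub>m n"
    using U by (simp_all add: unitary_mat_def)
  note U' = mat_adjoint_carrier[OF Uc]
  have to_span: "mat_adjoint U * A * U \<in> mat_span n B" if "A \<in> S" for A
    using span that by blast
  have cancel: "U * (mat_adjoint U * A * U) * mat_adjoint U = A" if "A \<in> S" for A
    using unitary_conjugation_cancel[OF U] S(1) that by blast
  have of_span: "U * M * mat_adjoint U \<in> S" if "M \<in> mat_span n B" for M
  proof -
    from that span obtain A where "A \<in> S" "M = mat_adjoint U * A * U" by blast
    with cancel show ?thesis by simp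
  qed
  have "1\<^sub>m n \<in> mat_span n B"
    using to_span[OF S(4)] U' UU by simp
  with spanning_set_pair_pattern[OF B] obtain J where pat: "pair_pattern n B J" and even: "\<forall>q\<in>J. even q"
    by blast
  interpret pair_pattern n B J by (rule pat)
  note D = submodule_matD[OF submodule_mat_span[OF B_carrier]]
  have "completely_positive_map n S \<Phi>"
    if lin: "linear_into_operators S \<Phi>" and pos: "positive_map n S \<Phi>"
    for \<Phi> :: "complex mat \<Rightarrow> 'k \<Rightarrow> 'k"
  proof -
    define \<Psi> where "\<Psi> M = \<Phi> (U * M * mat_adjoint U)" for M
    have "linear_into_operators (mat_span n B) \<Psi>"
      unfolding linear_into_operators_def
    proof (intro conjI ballI allI)
      fix M assume M: "M \<in> mat_span n B"
      then have Mc: "M \<in> carrier_mat n n" using D(1) by blast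
      show "\<Psi> M \<in> bounded_operators"
        using lin of_span[OF M] unfolding linear_into_operators_def \<Psi>_def by blast
      have "U * (c \<cdot>\<^sub>m M) * mat_adjoint U = c \<cdot>\<^sub>m (U * M * mat_adjoint U)" for c
        using mult_smult_distrib[OF Uc Mc] mult_smult_assoc_mat[OF mult_carrier_mat[OF Uc Mc] U'] by simp
      then show "\<Psi> (c \<cdot>\<^sub>m M) = (\<lambda>x. c *\<^sub>C \<Psi> M x)" for c
        using lin of_span[OF M] unfolding linear_into_operators_def \<Psi>_def by simp
      fix M' assume M': "M' \<in> mat_span n B"
      then have M'c: "M' \<in> carrier_mat n n" using D(1) by blast
      have "U * (M + M') * mat_adjoint U = U * M * mat_adjoint U + U * M' * mat_adjoint U"
        using mult_add_distrib_mat[OF Uc Mc M'c]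
          add_mult_distrib_mat[OF mult_carrier_mat[OF Uc Mc] mult_carrier_mat[OF Uc M'c] U'] by simp
      then show "\<Psi> (M + M') = (\<lambda>x. \<Psi> M x + \<Psi> M' x)"
        using lin of_span[OF M] of_span[OF M'] unfolding linear_into_operators_def \<Psi>_def by simp
    qed
    moreover have "positive_map n (mat_span n B) \<Psi>"
      using pos of_span psd_mat_conjugation[OF Uc] unfolding positive_map_def \<Psi>_def by blast
    ultimately have cp: "completely_positive_map n (mat_span n B) \<Psi>"
      using even by (intro positive_map_completely_positive) auto
    show ?thesis
      by (rule completely_positive_map_conjugation[OF Uc S(1) to_span _ cp])
        (simp_all add: \<Psi>_def cancel)
  qed
  then show ?thesis unfolding maximal_operator_system_def using assms(1) by blast
qed

end
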